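(* If $c=1$, then the $\mathbb Q$-algebras $\overline H_c(G(2,2,2))$ and $\overline{\underline H}_{-c}(\mu(G(2,2,2)))$ are not isomorphic.
   Context: Let $V=\mathbb Q^2$ with basis $x_1,x_2$ and dual basis $y_1,y_2$ of $V^*$. $G=G(2,2,2)$ is the Klein four-group $\{1,s,\bar s,s\bar s\}\subset GL(V)$, where $s$ swaps $x_1$ and $x_2$, and $\bar s$ sends $x_1\mapsto-x_2$, $x_2\mapsto-x_1$. $W=\mu(G(2,2,2))$ is the cyclic group of order $4$ generated by $\sigma$, where $\sigma(x_1)=x_2$, $\sigma(x_2)=-x_1$. Both groups act on $V^*$ by the dual action. For $c\in\mathbb Q$, $H_{0,c}(G)$ is the unital $\mathbb Q$-algebra generated by $x_1,x_2,y_1,y_2$ and $\mathbb QG$ with relations (for $i\ne j$ in $\{1,2\}$, $g\in G$) $x_1x_2=x_2x_1$, $y_1y_2=y_2y_1$, $gx_i=g(x_i)g$, $gy_i=g(y_i)g$, $y_ix_j-x_jy_i=c(s-\bar s)$, $y_ix_i-x_iy_i=-c(s+\bar s)$. The restricted rational Cherednik algebra is $\overline H_c(G)=H_{0,c}(G)/(I,I')$, where $I\subseteq S(V)$ and $I'\subseteq S(V^* )$ are the ideals generated by homogeneous $G$-invariants of positive degree and $(I,I')$ is the two-sided ideal they generate. For $\underline c\in\mathbb Q$, $\underline H_{0,\underline c}(W)$ is the unital $\mathbb Q$-algebra generated by $x_1,x_2,y_1,y_2$ and $\mathbb QW$ with relations (for $g\in W$, $i\in\{1,2\}$) $x_1x_2=-x_2x_1$,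 $y_1y_2=-y_2y_1$, $gx_i=g(x_i)g$, $gy_i=g(y_i)g$, $y_1x_2+x_2y_1=\underline c(\sigma-\sigma^{-1})$, $y_2x_1+x_1y_2=\underline c(\sigma^{-1}-\sigma)$, $y_ix_i-x_iy_i=\underline c(\sigma+\sigma^{-1})$. The algebra $\overline{\underline H}_{\underline c}(W)=\underline H_{0,\underline c}(W)/(I_W,I_W')$, where $I_W\subseteq S_{-1}(V)=\mathbb Q\langle x_1,x_2\rangle/(x_1x_2+x_2x_1)$ and $I_W'\subseteq S_{-1}(V^* )=\mathbb Q\langle y_1,y_2\rangle/(y_1y_2+y_2y_1)$ are the two-sided ideals generated by homogeneous $W$-invariants of positive degree and $(I_W,I_W')$ is the two-sided ideal they generate. *)

theory Defs
  imports
    "HOL-Analysis.Cartesian_Space"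
    "HOL-Library.Poly_Mapping"
    "HOL-Algebra.QuotRing"
    "HOL-Algebra.Module"
begin

section \<open>Associative algebras over the rationals\<close>

text \<open>Words are lists under concatenation, so that finitely supported rational functions on
  words, with the convolution product of \<^theory>\<open>HOL-Library.Poly_Mapping\<close>, are noncommutative
  polynomials.\<close>

instantiation list :: (type) monoid_add
begin
definition zero_list :: "'a list" where "zero_list = []"
definition plus_list :: "'a list \<Rightarrow> 'a list \<Rightarrow> 'a list" where "plus_list = append"
instance by standard (simp_all add: zero_list_def plus_list_def)
end

type_synonym 'x ncpoly = "'x list \<Rightarrow>\<^sub>0 rat"

definition var :: "'x \<Rightarrow> 'x ncpoly" where
  "var z = Poly_Mapping.single [z] 1"

definition scale :: "rat \<Rightarrow> 'x ncpoly \<Rightarrow> 'x ncpoly" where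
  "scale q p = Poly_Mapping.map ((*) q) p"

definition substitute :: "('x \<Rightarrow> 'z ncpoly) \<Rightarrow> 'x ncpoly \<Rightarrow> 'z ncpoly" where
  "substitute f p = (\<Sum>w\<in>Poly_Mapping.keys p. scale (Poly_Mapping.lookup p w) (prod_list (map f w)))"

definition homogeneous :: "nat \<Rightarrow> 'x ncpoly \<Rightarrow> bool" where
  "homogeneous d p \<longleftrightarrow> (\<forall>w\<in>Poly_Mapping.keys p. length w = d)"

text \<open>An associative unital algebra is a record of type \<^typ>\<open>(rat, 'a) module\<close>; the locale
  \<^locale>\<open>algebra\<close> is not used because it is restricted to commutative rings.\<close>

definition free_alg :: "'x set \<Rightarrow> (rat, 'x ncpoly) module" where
  "free_alg A =
     \<lparr>carrier = {p. \<forall>w\<in>Poly_Mapping.keys p. set w \<subseteq> A}, mult = (*), one = 1,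
      zero = 0, add = (+), smult = scale\<rparr>"

definition quot_alg :: "(rat, 'a) module \<Rightarrow> 'a set \<Rightarrow> (rat, 'a set) module" where
  "quot_alg A I = ring.extend (A Quot I)
     (module.fields (\<lambda>q C. \<Union>a\<in>C. I +>\<^bsub>A\<^esub> (q \<odot>\<^bsub>A\<^esub> a)))"

definition presented_alg :: "'x set \<Rightarrow> 'x ncpoly set \<Rightarrow> (rat, 'x ncpoly set) module" where
  "presented_alg A R = quot_alg (free_alg A) (genideal (free_alg A) R)"

definition alg_isomorphic :: "(rat, 'a) module \<Rightarrow> (rat, 'b) module \<Rightarrow> bool" where
  "alg_isomorphic A B \<longleftrightarrow>
     (\<exists>f\<in>ring_iso A B. \<forall>q. \<forall>a\<in>carrier A. f (q \<odot>\<^bsub>A\<^esub> a) = q \<odot>\<^bsub>B\<^esub> f a)"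


section \<open>Generators and group actions\<close>

text \<open>\<open>GX i\<close> and \<open>GY i\<close> stand for the basis vectors \<open>x\<^sub>i\<close> of V and \<open>y\<^sub>i\<close> of the dual space,
  \<open>GG g\<close> for the basis vector \<open>g\<close> of the group algebra. The index type \<^typ>\<open>2\<close> has the two
  elements 1 and 2 (with 2 = 0).\<close>

datatype gen = GX 2 | GY 2 | GG "rat^2^2"

abbreviation gx :: "2 \<Rightarrow> gen ncpoly" where "gx i \<equiv> var (GX i)"
abbreviation gy :: "2 \<Rightarrow> gen ncpoly" where "gy i \<equiv> var (GY i)"
abbreviation grp :: "rat^2^2 \<Rightarrow> gen ncpoly" where "grp g \<equiv> var (GG g)"

text \<open>The matrix \<open>g\<close> acts on column vectors by \<open>g *v v\<close>, and on the dual space, in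
  coordinates with respect to the dual basis, by its inverse transpose. The value on \<open>GG h\<close> plays
  no role: the action is only used on V and its dual.\<close>

fun gen_act :: "rat^2^2 \<Rightarrow> gen \<Rightarrow> gen ncpoly" where
  "gen_act g (GX i) = (\<Sum>j\<in>UNIV. scale ((g *v axis i 1) $ j) (gx j))"
| "gen_act g (GY i) = (\<Sum>j\<in>UNIV. scale ((transpose (matrix_inv g) *v axis i 1) $ j) (gy j))"
| "gen_act g (GG h) = grp (g ** h ** matrix_inv g)"

definition act :: "rat^2^2 \<Rightarrow> gen ncpoly \<Rightarrow> gen ncpoly" where
  "act g = substitute (gen_act g)"


section \<open>Cherednik-type algebras and their restricted quotients\<close>

text \<open>The sign \<open>\<epsilon>\<close> is 1 in the commutative and -1 in the anticommutative case. For
  \<open>Z = GX\<close> and \<open>Z = GY\<close>, \<open>sym_alg \<epsilon> Z\<close> is the (skew) symmetric algebra of V and of its dual.\<close>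

definition sym_rel :: "rat \<Rightarrow> (2 \<Rightarrow> gen) \<Rightarrow> gen ncpoly" where
  "sym_rel \<epsilon> Z = var (Z 1) * var (Z 2) - scale \<epsilon> (var (Z 2) * var (Z 1))"

definition sym_alg :: "rat \<Rightarrow> (2 \<Rightarrow> gen) \<Rightarrow> (rat, gen ncpoly set) module" where
  "sym_alg \<epsilon> Z = presented_alg (range Z) {sym_rel \<epsilon> Z}"

definition pos_invariants ::
  "(rat^2^2) set \<Rightarrow> rat \<Rightarrow> (2 \<Rightarrow> gen) \<Rightarrow> gen ncpoly set set" where
  "pos_invariants G \<epsilon> Z =
     {C \<in> carrier (sym_alg \<epsilon> Z).
        (\<exists>d>0. \<exists>p\<in>C. homogeneous d p) \<and> (\<forall>g\<in>G. act g ` C = C)}"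

definition invariant_ideal ::
  "(rat^2^2) set \<Rightarrow> rat \<Rightarrow> (2 \<Rightarrow> gen) \<Rightarrow> gen ncpoly set set" where
  "invariant_ideal G \<epsilon> Z = genideal (sym_alg \<epsilon> Z) (pos_invariants G \<epsilon> Z)"

definition gens :: "(rat^2^2) set \<Rightarrow> gen set" where
  "gens G = range GX \<union> range GY \<union> GG ` G"

text \<open>Relations are written as differences. The parameter \<open>R\<close> holds the relations between the
  \<open>x\<^sub>i\<close> and the \<open>y\<^sub>j\<close>.\<close>

definition cherednik_relations ::
  "(rat^2^2) set \<Rightarrow> rat \<Rightarrow> gen ncpoly set \<Rightarrow> gen ncpoly set" where
  "cherednik_relations G \<epsilon> R =
     {grp (mat 1) - 1}
     \<union> {grp g * grp h - grp (g ** h) | g h. g \<in> G \<and> h \<in> G}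
     \<union> {sym_rel \<epsilon> GX, sym_rel \<epsilon> GY}
     \<union> {grp g * gx i - act g (gx i) * grp g | g i. g \<in> G}
     \<union> {grp g * gy i - act g (gy i) * grp g | g i. g \<in> G}
     \<union> R"

definition cherednik_ideal ::
  "(rat^2^2) set \<Rightarrow> rat \<Rightarrow> gen ncpoly set \<Rightarrow> gen ncpoly set" where
  "cherednik_ideal G \<epsilon> R = genideal (free_alg (gens G)) (cherednik_relations G \<epsilon> R)"

definition cherednik_alg ::
  "(rat^2^2) set \<Rightarrow> rat \<Rightarrow> gen ncpoly set \<Rightarrow> (rat, gen ncpoly set) module" where
  "cherednik_alg G \<epsilon> R = presented_alg (gens G) (cherednik_relations G \<epsilon> R)"

text \<open>The canonical map \<open>sym_alg \<epsilon> Z \<rightarrow> cherednik_alg G \<epsilon> R\<close> sends the coset \<open>K + p\<close> to the coset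
  \<open>J + p = J + (K + p)\<close>, where \<open>K \<subseteq> J\<close> are the ideals of relations.\<close>

definition sym_to_cherednik ::
  "(rat^2^2) set \<Rightarrow> rat \<Rightarrow> gen ncpoly set \<Rightarrow> gen ncpoly set \<Rightarrow> gen ncpoly set" where
  "sym_to_cherednik G \<epsilon> R C = cherednik_ideal G \<epsilon> R <+>\<^bsub>free_alg (gens G)\<^esub> C"

definition restricted_alg ::
  "(rat^2^2) set \<Rightarrow> rat \<Rightarrow> gen ncpoly set \<Rightarrow> (rat, gen ncpoly set set) module" where
  "restricted_alg G \<epsilon> R = quot_alg (cherednik_alg G \<epsilon> R)
     (genideal (cherednik_alg G \<epsilon> R)
       (sym_to_cherednik G \<epsilon> R ` (invariant_ideal G \<epsilon> GX \<union> invariant_ideal G \<epsilon> GY)))"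


section \<open>The two groups and their algebras\<close>

text \<open>Matrices are listed by rows; the columns are the images of \<open>x\<^sub>1\<close> and \<open>x\<^sub>2\<close>.\<close>

definition s_mat :: "rat^2^2" where
  "s_mat = vector [vector [0, 1], vector [1, 0]]"

definition sbar_mat :: "rat^2^2" where
  "sbar_mat = vector [vector [0, -1], vector [-1, 0]]"

definition sigma_mat :: "rat^2^2" where
  "sigma_mat = vector [vector [0, -1], vector [1, 0]]"

definition G222 :: "(rat^2^2) set" where
  "G222 = {mat 1, s_mat, sbar_mat, s_mat ** sbar_mat}"

definition mu_G222 :: "(rat^2^2) set" where
  "mu_G222 = {mat 1, sigma_mat, sigma_mat ** sigma_mat, sigma_mat ** sigma_mat ** sigma_mat}"

definition G222_relations :: "rat \<Rightarrow> gen ncpoly set" where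
  "G222_relations c =
     {gy i * gx j - gx j * gy i - scale c (grp s_mat - grp sbar_mat) | i j. i \<noteq> j}
     \<union> {gy i * gx i - gx i * gy i - scale (- c) (grp s_mat + grp sbar_mat) | i. True}"

definition mu_G222_relations :: "rat \<Rightarrow> gen ncpoly set" where
  "mu_G222_relations c =
     {gy 1 * gx 2 + gx 2 * gy 1 - scale c (grp sigma_mat - grp (matrix_inv sigma_mat)),
      gy 2 * gx 1 + gx 1 * gy 2 - scale c (grp (matrix_inv sigma_mat) - grp sigma_mat)}
     \<union> {gy i * gx i - gx i * gy i - scale c (grp sigma_mat + grp (matrix_inv sigma_mat)) | i. True}"

definition restricted_cherednik_G222 :: "rat \<Rightarrow> (rat, gen ncpoly set set) module" where
  "restricted_cherednik_G222 c = restricted_alg G222 1 (G222_relations c)"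

definition restricted_braided_mu_G222 :: "rat \<Rightarrow> (rat, gen ncpoly set set) module" where
  "restricted_braided_mu_G222 c = restricted_alg mu_G222 (- 1) (mu_G222_relations c)"

end

theory Submission
  imports Defs
begin

text \<open>
  Both algebras have dimension 64 and are semisimple, but their centres differ. The restricted rational Cherednik
  algebra of G(2,2,2) at the parameter 1 is the product of four matrix algebras \<open>M\<^sub>4(\<rat>)\<close>, one for each
  character of the Klein four-group. The characters of the cyclic group of order 4 take the values
  \<open>\<plusminus>\<i>\<close>, and the braided algebra has a factor \<open>M\<^sub>4(\<rat>(\<i>))\<close>. The proof extracts the
  following contrast.

  \<^item> The braided algebra at the parameter -1 has a representation on \<open>\<complex>\<^sup>4\<close>, the Verma module with lowest
  weight \<open>\<sigma> \<mapsto> \<i>\<close>, in which the element \<open>\<sigma>\<^sup>2 (y\<^sub>1 x\<^sub>2 + x\<^sub>1 y\<^sub>2) / 2\<close> acts as multiplication by \<open>\<i>\<close>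
  (\<open>braided_representation\<close>).

  \<^item> If the restricted Cherednik algebra of G(2,2,2) maps to a real algebra, then no element of the
  image that commutes with the image has square -1 (\<open>restricted_G222_no_imaginary_unit\<close>). This is lowest
  weight theory: a lowest weight vector \<open>p\<close> of weight \<open>(\<plusminus>1, \<plusminus>1)\<close> generates a Verma module on which
  a suitable element \<open>E\<close> is a nonzero multiple of the projection onto the line of \<open>p\<close>, so that everything in the
  image that commutes with \<open>E\<close> acts on \<open>p\<close> by a real scalar; a square root of -1 would force all lowest weight vectors to
  vanish. But the four lowest weight vectors \<open>(1 \<plusminus> S) (1 \<plusminus> T) E\<close> have sum \<open>4 E\<close>, and \<open>E\<close> generates the unit
  ideal (\<open>no_imaginary_unit\<close>, \<open>E_nonzero\<close>).

  An isomorphism would carry the representation of the braided algebra to one of the Cherednik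
  algebra and contradict the second point. Passing from presentations to homomorphisms is the
  purpose of \<open>hom_factors_through_restricted\<close>, \<open>proj_relation\<close> and \<open>proj_invariant\<close>.
\<close>

section \<open>Noncommutative polynomials and their evaluation\<close>

lemma scale_eq_mult: "scale q p = Poly_Mapping.single [] q * p"
  unfolding scale_def mult_map_scale_conv_mult by (simp add: zero_list_def)

lemma single_Nil_1 [simp]: "Poly_Mapping.single [] 1 = (1 :: 'x ncpoly)"
  using single_one[where 'a = "'x list" and 'b = rat] by (simp add: zero_list_def)

text \<open>With \<open>single_Nil_1\<close>, this lets every induction on words run over the generators.\<close>

lemma single_Cons: "Poly_Mapping.single (a # w) q = var a * Poly_Mapping.single w (q::rat)"
  by (simp add: var_def mult_single plus_list_def)

abbreviation (input) ncpolys :: "'x set \<Rightarrow> 'x ncpoly set" where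
  "ncpolys A \<equiv> carrier (free_alg A)"

lemma free_alg_simps [simp]:
  "(\<otimes>\<^bsub>free_alg A\<^esub>) = (*)" "\<one>\<^bsub>free_alg A\<^esub> = 1" "\<zero>\<^bsub>free_alg A\<^esub> = 0" "(\<oplus>\<^bsub>free_alg A\<^esub>) = (+)"
  by (simp_all add: free_alg_def)

lemma ncpolys_iff: "p \<in> ncpolys A \<longleftrightarrow> (\<forall>w\<in>Poly_Mapping.keys p. set w \<subseteq> A)"
  by (simp add: free_alg_def)

lemma single_in_ncpolys [simp]: "set w \<subseteq> A \<Longrightarrow> Poly_Mapping.single w q \<in> ncpolys A"
  by (simp add: ncpolys_iff)

lemma ncpolys_closed [simp]:
  "0 \<in> ncpolys A" "1 \<in> ncpolys A" "a \<in> A \<Longrightarrow> var a \<in> ncpolys A"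
  "p \<in> ncpolys A \<Longrightarrow> q \<in> ncpolys A \<Longrightarrow> p + q \<in> ncpolys A"
  "p \<in> ncpolys A \<Longrightarrow> q \<in> ncpolys A \<Longrightarrow> p * q \<in> ncpolys A"
  "p \<in> ncpolys A \<Longrightarrow> - p \<in> ncpolys A"
  "p \<in> ncpolys A \<Longrightarrow> q \<in> ncpolys A \<Longrightarrow> p - q \<in> ncpolys A"
proof -
  show "0 \<in> ncpolys A" "1 \<in> ncpolys A" "a \<in> A \<Longrightarrow> var a \<in> ncpolys A"
    by (simp_all add: ncpolys_iff var_def zero_list_def)
  show "p \<in> ncpolys A \<Longrightarrow> q \<in> ncpolys A \<Longrightarrow> p + q \<in> ncpolys A"
    using keys_add[of p q] by (auto simp: ncpolys_iff)
  show "p \<in> ncpolys A \<Longrightarrow> q \<in> ncpolys A \<Longrightarrow> p * q \<in> ncpolys A"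
    using keys_mult[of p q] by (fastforce simp: ncpolys_iff plus_list_def)
  show "p \<in> ncpolys A \<Longrightarrow> - p \<in> ncpolys A"
    by (simp add: ncpolys_iff in_keys_iff)
  show "p \<in> ncpolys A \<Longrightarrow> q \<in> ncpolys A \<Longrightarrow> p - q \<in> ncpolys A"
    using keys_diff[of p q] by (auto simp: ncpolys_iff)
qed

lemma scale_in_ncpolys [simp]: "p \<in> ncpolys A \<Longrightarrow> scale q p \<in> ncpolys A"
  by (simp add: scale_eq_mult)

lemma ncpolys_mono: "A \<subseteq> B \<Longrightarrow> ncpolys A \<subseteq> ncpolys B"
  unfolding ncpolys_iff subset_iff by blast

lemma ring_free_alg: "ring (free_alg A)"
proof (rule ringI)
  show "abelian_group (free_alg A)"
  proof (rule abelian_groupI)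
    fix p assume "p \<in> ncpolys A"
    then show "\<exists>q\<in>ncpolys A. q \<oplus>\<^bsub>free_alg A\<^esub> p = \<zero>\<^bsub>free_alg A\<^esub>"
      by (intro bexI[of _ "- p"]) auto
  qed (auto simp: add_ac)
  show "Group.monoid (free_alg A)"
    by (rule Group.monoidI) (auto simp: mult.assoc)
qed (auto simp: algebra_simps)

lemma ncpolys_word_induct [consumes 1, case_names word add]:
  assumes "p \<in> ncpolys A"
    and word: "\<And>w q. set w \<subseteq> A \<Longrightarrow> P (Poly_Mapping.single w q)"
    and add: "\<And>p q. p \<in> ncpolys A \<Longrightarrow> q \<in> ncpolys A \<Longrightarrow> P p \<Longrightarrow> P q \<Longrightarrow> P (p + q)"
  shows "P p"
  using assms(1)
proof (induction p rule: update_induct)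
  case const
  then show ?case using word[of "[]" 0] by simp
next
  case (update p w r)
  have eq: "Poly_Mapping.update w r p = Poly_Mapping.single w r + p"
    using update by (intro poly_mapping_eqI)
      (auto simp: lookup_update lookup_add lookup_single when_def in_keys_iff)
  have "set w \<subseteq> A" "p \<in> ncpolys A"
    using update by (auto simp: ncpolys_iff keys_update)
  then show ?case
    unfolding eq using update.IH by (intro add word) auto
qed

lemma ncpolys_induct [consumes 1, case_names const gen add]:
  assumes "p \<in> ncpolys A"
    and const: "\<And>q. P (Poly_Mapping.single [] q)"
    and gen: "\<And>a p. a \<in> A \<Longrightarrow> p \<in> ncpolys A \<Longrightarrow> P p \<Longrightarrow> P (var a * p)"
    and add: "\<And>p q. p \<in> ncpolys A \<Longrightarrow> q \<in> ncpolys A \<Longrightarrow> P p \<Longrightarrow> P q \<Longrightarrow> P (p + q)"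
  shows "P p"
  using assms(1)
proof (induction rule: ncpolys_word_induct)
  case (word w q)
  then show ?case
    by (induction w) (auto simp: single_Cons intro: const gen)
qed (rule add)

text \<open>The scalars of the target enter through a map \<open>\<kappa>\<close>, so that substitution (where
  \<open>\<kappa>\<close> embeds the rationals as constant polynomials) and representations on real vector
  spaces (where \<open>\<kappa>\<close> passes through the reals) are instances of the same homomorphism.\<close>

definition evaluate :: "(rat \<Rightarrow> 'r::ring_1) \<Rightarrow> ('x \<Rightarrow> 'r) \<Rightarrow> 'x ncpoly \<Rightarrow> 'r" where
  "evaluate \<kappa> h p =
     (\<Sum>w\<in>Poly_Mapping.keys p. \<kappa> (Poly_Mapping.lookup p w) * prod_list (map h w))"

locale central_scalars =
  fixes \<kappa> :: "rat \<Rightarrow> 'r::ring_1"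
  assumes scalar_add: "\<kappa> (q + r) = \<kappa> q + \<kappa> r"
    and scalar_mult: "\<kappa> (q * r) = \<kappa> q * \<kappa> r"
    and scalar_1: "\<kappa> 1 = 1"
    and scalar_central: "\<kappa> q * x = x * \<kappa> q"
begin

lemma scalar_0: "\<kappa> 0 = 0"
  using scalar_add[of 0 0] by simp

lemma evaluate_single: "evaluate \<kappa> h (Poly_Mapping.single w q) = \<kappa> q * prod_list (map h w)"
  by (simp add: evaluate_def scalar_0)

lemma evaluate_superset:
  "finite S \<Longrightarrow> Poly_Mapping.keys p \<subseteq> S \<Longrightarrow>
    evaluate \<kappa> h p = (\<Sum>w\<in>S. \<kappa> (Poly_Mapping.lookup p w) * prod_list (map h w))"
  unfolding evaluate_def by (rule sum.mono_neutral_left) (auto simp: in_keys_iff scalar_0)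

lemma evaluate_add: "evaluate \<kappa> h (p + q) = evaluate \<kappa> h p + evaluate \<kappa> h q"
  using keys_add[of p q]
  by (simp add: evaluate_superset[of "Poly_Mapping.keys p \<union> Poly_Mapping.keys q"]
      lookup_add scalar_add distrib_right sum.distrib)

lemma evaluate_mult: "evaluate \<kappa> h (p * q) = evaluate \<kappa> h p * evaluate \<kappa> h q"
proof -
  have "p \<in> ncpolys UNIV" "q \<in> ncpolys UNIV"
    by (simp_all add: ncpolys_iff)
  then show ?thesis
  proof (induction p rule: ncpolys_word_induct)
    case (word w r)
    from word(2) show ?case
    proof (induction q rule: ncpolys_word_induct)
      case (word v s)
      have "\<kappa> s * (prod_list (map h w) * x) = prod_list (map h w) * (\<kappa> s * x)" for x
        by (metis scalar_central mult.assoc)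
      then show ?case
        by (simp add: evaluate_single mult_single plus_list_def scalar_mult mult.assoc)
    qed (simp add: evaluate_add distrib_left)
  qed (simp add: evaluate_add distrib_right)
qed

lemma evaluate_1: "evaluate \<kappa> h 1 = 1"
  using evaluate_single[of h "[]" 1] by (simp add: scalar_1)

lemma evaluate_var: "evaluate \<kappa> h (var a) = h a"
  by (simp add: var_def evaluate_single scalar_1)

lemma evaluate_uminus: "evaluate \<kappa> h (- p) = - evaluate \<kappa> h p"
  using evaluate_add[of h p "- p"] evaluate_single[of h "[]" 0]
  by (simp add: scalar_0 eq_neg_iff_add_eq_0 add.commute)

lemma evaluate_diff: "evaluate \<kappa> h (p - q) = evaluate \<kappa> h p - evaluate \<kappa> h q"
  using evaluate_add[of h p "- q"] by (simp add: evaluate_uminus)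

lemma evaluate_scale: "evaluate \<kappa> h (scale q p) = \<kappa> q * evaluate \<kappa> h p"
  by (simp add: scale_eq_mult evaluate_mult evaluate_single)

lemmas evaluate_simps =
  evaluate_add evaluate_mult evaluate_1 evaluate_var evaluate_uminus evaluate_diff evaluate_scale

end

lemma single_Nil_central: "Poly_Mapping.single [] q * p = p * (Poly_Mapping.single [] q :: 'x ncpoly)"
proof -
  have "p \<in> ncpolys UNIV"
    by (simp add: ncpolys_iff)
  then show ?thesis
    by (induction p rule: ncpolys_word_induct)
       (simp_all add: distrib_left distrib_right mult_single plus_list_def mult.commute)
qed

interpretation polynomials: central_scalars "Poly_Mapping.single [] :: rat \<Rightarrow> 'x ncpoly"
  by standard (simp_all add: single_add mult_single plus_list_def single_Nil_central)

lemma substitute_eq_evaluate: "substitute f = evaluate (Poly_Mapping.single []) f"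
  by (rule ext) (simp add: substitute_def evaluate_def scale_eq_mult)

lemma evaluate_substitute:
  assumes "central_scalars \<kappa>"
  shows "evaluate \<kappa> h (substitute f p) = evaluate \<kappa> (\<lambda>a. evaluate \<kappa> h (f a)) p"
proof -
  interpret central_scalars \<kappa> by fact
  have "p \<in> ncpolys UNIV"
    by (simp add: ncpolys_iff)
  then show ?thesis
    unfolding substitute_eq_evaluate
    by (induction p rule: ncpolys_induct)
       (simp_all add: polynomials.evaluate_simps polynomials.evaluate_single evaluate_simps
         evaluate_single)
qed

section \<open>Homomorphisms from quotient algebras to ring types\<close>

text \<open>The targets of representations are types of class \<^class>\<open>ring_1\<close>. This record makes them available as
  codomains of \<^const>\<open>ring_hom\<close>.\<close>

definition type_ring :: "'r::ring_1 ring" where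
  "type_ring = \<lparr>carrier = UNIV, mult = (*), one = 1, zero = 0, add = (+)\<rparr>"

lemma type_ring_simps [simp]:
  "carrier type_ring = UNIV" "(\<otimes>\<^bsub>type_ring\<^esub>) = (*)" "\<one>\<^bsub>type_ring\<^esub> = 1"
  "\<zero>\<^bsub>type_ring\<^esub> = 0" "(\<oplus>\<^bsub>type_ring\<^esub>) = (+)"
  by (simp_all add: type_ring_def)

lemma ring_type_ring: "ring (type_ring :: 'r::ring_1 ring)"
proof (rule ringI)
  show "abelian_group (type_ring :: 'r ring)"
  proof (rule abelian_groupI)
    fix x :: 'r
    show "\<exists>y\<in>carrier type_ring. y \<oplus>\<^bsub>type_ring\<^esub> x = \<zero>\<^bsub>type_ring\<^esub>"
      by (intro bexI[of _ "- x"]) auto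
  qed (auto simp: add_ac)
  show "Group.monoid (type_ring :: 'r ring)"
    by (rule Group.monoidI) (auto simp: mult.assoc)
qed (auto simp: algebra_simps)

lemma type_hom_0:
  assumes "ring A" "\<phi> \<in> ring_hom A type_ring"
  shows "\<phi> \<zero>\<^bsub>A\<^esub> = 0"
  using ring_hom_zero[OF assms(2,1) ring_type_ring] by simp

lemma ideal_kernel:
  assumes "ring A" "\<phi> \<in> ring_hom A type_ring"
  shows "ideal {a \<in> carrier A. \<phi> a = 0} A"
proof -
  interpret ring_hom_ring A type_ring \<phi>
    by (rule ring_hom_ringI2) (use assms ring_type_ring in auto)
  have "a_kernel A type_ring \<phi> = {a \<in> carrier A. \<phi> a = 0}"
    unfolding a_kernel_def' type_ring_simps ..
  with kernel_is_ideal show ?thesis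
    by metis
qed

lemma hom_vanishes_on_genideal:
  assumes "ring A" "\<phi> \<in> ring_hom A type_ring" "S \<subseteq> carrier A" "\<And>a. a \<in> S \<Longrightarrow> \<phi> a = 0"
    and "a \<in> genideal A S"
  shows "\<phi> a = 0"
proof -
  have "S \<subseteq> {a \<in> carrier A. \<phi> a = 0}"
    using assms(3,4) by blast
  from ring.genideal_minimal[OF assms(1) ideal_kernel[OF assms(1,2)] this] show ?thesis
    using assms(5) by blast
qed

lemma quot_alg_simps [simp]:
  "carrier (quot_alg A I) = carrier (A Quot I)"
  "(\<otimes>\<^bsub>quot_alg A I\<^esub>) = (\<otimes>\<^bsub>A Quot I\<^esub>)" "\<one>\<^bsub>quot_alg A I\<^esub> = \<one>\<^bsub>A Quot I\<^esub>"
  "\<zero>\<^bsub>quot_alg A I\<^esub> = \<zero>\<^bsub>A Quot I\<^esub>" "(\<oplus>\<^bsub>quot_alg A I\<^esub>) = (\<oplus>\<^bsub>A Quot I\<^esub>)"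
  by (simp_all add: quot_alg_def ring.defs module.defs)

lemma carrier_quot_alg: "carrier (quot_alg A I) = (\<lambda>a. I +>\<^bsub>A\<^esub> a) ` carrier A"
  by (auto simp: FactRing_def A_RCOSETS_def')

locale algebra_ideal = ideal I A for I :: "'a set" and A :: "(rat, 'a) module" (structure)
begin

lemma quot_alg_ring: "ring (quot_alg A I)"
proof -
  interpret Q: ring "A Quot I"
    by (rule quotient_is_ring)
  show ?thesis
  proof (rule ringI)
    show "abelian_group (quot_alg A I)"
      by (rule abelian_groupI) (auto simp: Q.add.m_ac intro: Q.add.l_inv_ex)
    show "Group.monoid (quot_alg A I)"
      by (rule Group.monoidI) (auto simp: Q.m_assoc)
  qed (auto simp: Q.l_distr Q.r_distr)
qed

lemma coset_hom: "(\<lambda>a. I +> a) \<in> ring_hom A (quot_alg A I)"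
  using rcos_ring_hom unfolding ring_hom_def quot_alg_simps .

lemma hom_const_on_coset:
  assumes "\<phi> \<in> ring_hom A type_ring" "\<And>i. i \<in> I \<Longrightarrow> \<phi> i = 0" "a \<in> carrier A" "b \<in> I +> a"
  shows "\<phi> b = \<phi> a"
proof -
  obtain i where "i \<in> I" "b = i \<oplus> a"
    using assms(4) by (auto simp: a_r_coset_def')
  then show ?thesis
    using ring_hom_add[OF assms(1), of i a] assms(2,3) a_Hcarr by simp
qed

text \<open>The universal property of the quotient, for homomorphisms into a ring type.\<close>

lemma hom_factors_through_quot_alg:
  assumes \<phi>: "\<phi> \<in> ring_hom A type_ring" and 0: "\<And>i. i \<in> I \<Longrightarrow> \<phi> i = 0"
  obtains \<rho> where "\<rho> \<in> ring_hom (quot_alg A I) type_ring"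
    and "\<And>a. a \<in> carrier A \<Longrightarrow> \<rho> (I +> a) = \<phi> a"
proof -
  define \<rho> where "\<rho> C = \<phi> (SOME a. a \<in> C)" for C
  have eq: "\<rho> (I +> a) = \<phi> a" if "a \<in> carrier A" for a
  proof -
    have "(SOME b. b \<in> I +> a) \<in> I +> a"
      using a_rcos_self[OF that] by (rule someI)
    then show ?thesis
      unfolding \<rho>_def using hom_const_on_coset[OF \<phi> 0 that] by blast
  qed
  moreover have "\<rho> \<in> ring_hom (quot_alg A I) type_ring"
  proof (rule ring_hom_memI)
    fix C D assume "C \<in> carrier (quot_alg A I)" "D \<in> carrier (quot_alg A I)"
    then obtain a b where ab: "a \<in> carrier A" "b \<in> carrier A" "C = I +> a" "D = I +> b"
      unfolding carrier_quot_alg by blast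
    show "\<rho> (C \<otimes>\<^bsub>quot_alg A I\<^esub> D) = \<rho> C \<otimes>\<^bsub>type_ring\<^esub> \<rho> D"
      using ring_hom_mult[OF coset_hom ab(1,2)] ring_hom_mult[OF \<phi> ab(1,2)] ab eq
      by (metis m_closed)
    show "\<rho> (C \<oplus>\<^bsub>quot_alg A I\<^esub> D) = \<rho> C \<oplus>\<^bsub>type_ring\<^esub> \<rho> D"
      using ring_hom_add[OF coset_hom ab(1,2)] ring_hom_add[OF \<phi> ab(1,2)] ab eq
      by (metis a_closed)
  next
    show "\<rho> \<one>\<^bsub>quot_alg A I\<^esub> = \<one>\<^bsub>type_ring\<^esub>"
      using ring_hom_one[OF coset_hom] ring_hom_one[OF \<phi>] eq by (metis one_closed)
  qed simp
  ultimately show thesis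
    by (rule that[rotated])
qed

end

lemma real_algebra_scalars: "central_scalars (\<lambda>q. of_real (of_rat q) :: 'r::real_algebra_1)"
  by standard (simp_all add: of_rat_add of_rat_mult of_real_def scaleR_add_left)

text \<open>An additive map that is the identity on integers respects division by them. Hence a ring
  homomorphism into a real algebra sends each rational constant to the corresponding scalar.\<close>

lemma type_hom_scalar:
  fixes \<phi> :: "'x ncpoly \<Rightarrow> 'r::real_algebra_1"
  assumes "\<phi> \<in> ring_hom (free_alg A) type_ring"
  shows "\<phi> (Poly_Mapping.single [] q) = of_real (of_rat q)"
proof -
  define \<theta> where "\<theta> q = \<phi> (Poly_Mapping.single [] q)" for q
  have add: "\<theta> (q + r) = \<theta> q + \<theta> r" and mult: "\<theta> (q * r) = \<theta> q * \<theta> r" for q r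
    using ring_hom_add[OF assms, of "Poly_Mapping.single [] q" "Poly_Mapping.single [] r"]
      ring_hom_mult[OF assms, of "Poly_Mapping.single [] q" "Poly_Mapping.single [] r"]
    by (simp_all add: \<theta>_def single_add mult_single plus_list_def)
  have one: "\<theta> 1 = 1"
    using ring_hom_one[OF assms] by (simp add: \<theta>_def)
  have zero: "\<theta> 0 = 0"
    using add[of 0 0] by simp
  have nat: "\<theta> (of_nat n) = of_nat n" for n
    by (induction n) (simp_all add: zero one add)
  have minus: "\<theta> (- r) = - \<theta> r" for r
    using add[of r "- r"] zero by (simp add: minus_unique)
  have int: "\<theta> (of_int n) = of_int n" for n
    by (cases n rule: int_cases2) (simp_all add: nat minus)
  obtain m n where q: "q = of_int m / of_int n" "n > 0"
    by (cases q) (auto simp: Fract_of_int_quotient)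
  have "of_int n * \<theta> q = of_int m"
    using mult[of "of_int n" q] q by (simp add: int)
  then have "real_of_int n *\<^sub>R \<theta> q = of_real (of_int m)"
    by (simp add: scaleR_conv_of_real)
  then have "inverse (real_of_int n) *\<^sub>R real_of_int n *\<^sub>R \<theta> q =
      inverse (real_of_int n) *\<^sub>R of_real (of_int m)"
    by (rule arg_cong)
  then have "\<theta> q = inverse (real_of_int n) *\<^sub>R of_real (of_int m)"
    using q(2) by (simp del: of_real_of_int_eq)
  also have "\<dots> = of_real (inverse (real_of_int n) * of_int m)"
    by (simp only: scaleR_conv_of_real of_real_mult)
  also have "inverse (real_of_int n) * of_int m = of_rat q"
    unfolding q(1) of_rat_divide by (simp add: divide_inverse mult.commute)
  finally show ?thesis
    by (simp add: \<theta>_def)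
qed

lemma type_hom_eq_evaluate:
  fixes \<phi> :: "'x ncpoly \<Rightarrow> 'r::real_algebra_1"
  assumes \<phi>: "\<phi> \<in> ring_hom (free_alg A) type_ring" and "p \<in> ncpolys A"
  shows "\<phi> p = evaluate (\<lambda>q. of_real (of_rat q)) (\<lambda>a. \<phi> (var a)) p"
proof -
  interpret central_scalars "\<lambda>q. of_real (of_rat q) :: 'r"
    by (rule real_algebra_scalars)
  show ?thesis
    using assms(2)
  proof (induction p rule: ncpolys_induct)
    case (const q)
    then show ?case
      by (simp add: evaluate_single type_hom_scalar[OF \<phi>])
  next
    case (gen a p)
    then show ?case
      using ring_hom_mult[OF \<phi>, of "var a" p] by (simp add: evaluate_simps)
  next
    case (add p q)
    then show ?case
      using ring_hom_add[OF \<phi>, of p q] by (simp add: evaluate_simps)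
  qed
qed

section \<open>Homomorphisms and restricted algebras\<close>

lemma coset_free_alg: "K +>\<^bsub>free_alg A\<^esub> p = (\<lambda>k. k + p) ` K"
  by (auto simp: a_r_coset_def')

lemma gen_act_in_ncpolys:
  "gen_act g (GX i) \<in> ncpolys (range GX)" "gen_act g (GY i) \<in> ncpolys (range GY)"
  by (simp_all add: sum_2)

lemma act_var [simp]: "act g (var a) = gen_act g a"
  unfolding act_def substitute_eq_evaluate by (rule polynomials.evaluate_var)

text \<open>A restricted algebra is a quotient of a quotient of a free algebra, and the ideal of the second
  step is generated by images of ideals of (skew) symmetric algebras, which are themselves quotients
  of smaller free algebras. This locale reduces statements about it to statements about
  noncommutative polynomials: \<open>proj\<close> is the composite projection, and the lemmas
  \<open>proj_relation\<close>, \<open>proj_invariant\<close> and \<open>hom_factors_through_restricted\<close> say which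
  polynomials it kills and which homomorphisms factor through it.\<close>

locale cherednik =
  fixes G :: "(rat^2^2) set" and \<epsilon> :: rat and R :: "gen ncpoly set"
  assumes mat_1_in: "mat 1 \<in> G"
    and closed: "g \<in> G \<Longrightarrow> h \<in> G \<Longrightarrow> g ** h \<in> G"
    and R_in: "R \<subseteq> ncpolys (gens G)"
begin

abbreviation "J \<equiv> cherednik_ideal G \<epsilon> R"
abbreviation "H \<equiv> cherednik_alg G \<epsilon> R"
abbreviation "K Z \<equiv> genideal (free_alg (range Z)) {sym_rel \<epsilon> Z}"
abbreviation "invariants \<equiv>
  sym_to_cherednik G \<epsilon> R ` (invariant_ideal G \<epsilon> GX \<union> invariant_ideal G \<epsilon> GY)"
abbreviation "I \<equiv> genideal H invariants"

definition proj :: "gen ncpoly \<Rightarrow> gen ncpoly set set" where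
  "proj p = I +>\<^bsub>H\<^esub> (J +>\<^bsub>free_alg (gens G)\<^esub> p)"

lemma in_gens: "GX i \<in> gens G" "GY i \<in> gens G" "g \<in> G \<Longrightarrow> GG g \<in> gens G"
  by (auto simp: gens_def)

lemma range_subset_gens: "Z \<in> {GX, GY} \<Longrightarrow> range Z \<subseteq> gens G"
  by (auto simp: gens_def)

lemma sym_rel_in: "sym_rel \<epsilon> Z \<in> ncpolys (range Z)"
  by (simp add: sym_rel_def)

lemma relations_in: "cherednik_relations G \<epsilon> R \<subseteq> ncpolys (gens G)"
proof -
  have "gen_act g (GX i) \<in> ncpolys (gens G)" "gen_act g (GY i) \<in> ncpolys (gens G)" for g i
    using gen_act_in_ncpolys ncpolys_mono[OF range_subset_gens] by blast+
  moreover have "sym_rel \<epsilon> GX \<in> ncpolys (gens G)" "sym_rel \<epsilon> GY \<in> ncpolys (gens G)"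
    using sym_rel_in ncpolys_mono[OF range_subset_gens] by blast+
  ultimately show ?thesis
    using R_in mat_1_in closed by (auto simp: cherednik_relations_def in_gens)
qed

sublocale J: algebra_ideal J "free_alg (gens G)"
  unfolding algebra_ideal_def cherednik_ideal_def
  by (rule ring.genideal_ideal[OF ring_free_alg relations_in])

lemma H_eq: "H = quot_alg (free_alg (gens G)) J"
  by (simp add: cherednik_alg_def presented_alg_def cherednik_ideal_def)

lemma ring_H: "ring H"
  unfolding H_eq by (rule J.quot_alg_ring)

lemma carrier_H: "carrier H = (\<lambda>p. J +>\<^bsub>free_alg (gens G)\<^esub> p) ` ncpolys (gens G)"
  unfolding H_eq by (rule carrier_quot_alg)

lemma K_ideal: "algebra_ideal (K Z) (free_alg (range Z))"
  unfolding algebra_ideal_def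
  by (rule ring.genideal_ideal[OF ring_free_alg]) (simp add: sym_rel_in)

lemma sym_alg_eq: "sym_alg \<epsilon> Z = quot_alg (free_alg (range Z)) (K Z)"
  by (simp add: sym_alg_def presented_alg_def)

lemma ring_sym_alg: "ring (sym_alg \<epsilon> Z)"
  unfolding sym_alg_eq by (rule algebra_ideal.quot_alg_ring[OF K_ideal])

lemma carrier_sym_alg:
  "carrier (sym_alg \<epsilon> Z) = (\<lambda>p. K Z +>\<^bsub>free_alg (range Z)\<^esub> p) ` ncpolys (range Z)"
  unfolding sym_alg_eq by (rule carrier_quot_alg)

lemma relation_in_J: "r \<in> cherednik_relations G \<epsilon> R \<Longrightarrow> r \<in> J"
  unfolding cherednik_ideal_def using ring.genideal_self[OF ring_free_alg relations_in] by blast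

lemma K_subset_J:
  assumes "Z \<in> {GX, GY}"
  shows "K Z \<subseteq> J"
proof -
  have "(\<lambda>p. p) \<in> ring_hom (free_alg (range Z)) (free_alg (gens G))"
    using ncpolys_mono[OF range_subset_gens[OF assms]] by (intro ring_hom_memI) auto
  then interpret inc: ring_hom_ring "free_alg (range Z)" "free_alg (gens G)" "\<lambda>p. p"
    by (intro ring_hom_ringI2 ring_free_alg)
  have "sym_rel \<epsilon> Z \<in> J"
    using assms by (intro relation_in_J) (auto simp: cherednik_relations_def)
  then have "K Z \<subseteq> {p \<in> ncpolys (range Z). p \<in> J}"
    using inc.ideal_vimage[OF J.ideal_axioms] sym_rel_in
    by (intro ring.genideal_minimal[OF ring_free_alg]) auto
  then show ?thesis
    by blast
qed

text \<open>\<open>K \<subseteq> J\<close>, so adding \<open>J\<close> to a coset of \<open>K\<close> gives a coset of \<open>J\<close>.\<close>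

lemma sym_to_cherednik_coset:
  assumes "Z \<in> {GX, GY}" "p \<in> ncpolys (range Z)"
  shows "sym_to_cherednik G \<epsilon> R (K Z +>\<^bsub>free_alg (range Z)\<^esub> p) = J +>\<^bsub>free_alg (gens G)\<^esub> p"
proof -
  interpret K: algebra_ideal "K Z" "free_alg (range Z)"
    by (rule K_ideal)
  have 0: "0 \<in> K Z"
    using additive_subgroup.zero_closed[OF K.additive_subgroup_axioms] by simp
  have 1: "h + (k + p) \<in> (\<lambda>h. h + p) ` J" if "h \<in> J" "k \<in> K Z" for h k
  proof (rule image_eqI[of _ _ "h + k"])
    show "h + k \<in> J"
      using additive_subgroup.a_closed[OF J.additive_subgroup_axioms, of h k]
        K_subset_J[OF assms(1)] that by auto
  qed (simp add: add.assoc)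
  have 2: "h + p \<in> {h + (k + p) | h k. h \<in> J \<and> k \<in> K Z}" if "h \<in> J" for h
    using 0 that by force
  have 3: "sym_to_cherednik G \<epsilon> R (K Z +>\<^bsub>free_alg (range Z)\<^esub> p) =
      {h + (k + p) | h k. h \<in> J \<and> k \<in> K Z}"
    unfolding sym_to_cherednik_def coset_free_alg set_add_def' by auto
  show ?thesis
    unfolding 3 unfolding coset_free_alg 
  proof (intro equalityI subsetI)
    fix q assume "q \<in> {h + (k + p) | h k. h \<in> J \<and> k \<in> K Z}"
    then obtain h k where "h \<in> J" "k \<in> K Z" "q = h + (k + p)"
      by (elim CollectE exE conjE)
    with 1 show "q \<in> (\<lambda>h. h + p) ` J"
      by simp
  next
    fix q assume "q \<in> (\<lambda>h. h + p) ` J"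
    then show "q \<in> {h + (k + p) | h k. h \<in> J \<and> k \<in> K Z}"
      using 2 by (elim imageE) (simp only:)
  qed
qed

lemma invariant_ideal_is_ideal: "ideal (invariant_ideal G \<epsilon> Z) (sym_alg \<epsilon> Z)"
  unfolding invariant_ideal_def
  by (rule ring.genideal_ideal[OF ring_sym_alg]) (auto simp: pos_invariants_def)

lemma invariants_in: "invariants \<subseteq> carrier H"
proof -
  have "sym_to_cherednik G \<epsilon> R C \<in> carrier H" if "Z \<in> {GX, GY}" "C \<in> invariant_ideal G \<epsilon> Z" for Z C
  proof -
    have "C \<in> carrier (sym_alg \<epsilon> Z)"
      using ideal.Icarr[OF invariant_ideal_is_ideal that(2)] .
    then obtain p where "p \<in> ncpolys (range Z)" "C = K Z +>\<^bsub>free_alg (range Z)\<^esub> p"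
      unfolding carrier_sym_alg by blast
    with that(1) show ?thesis
      unfolding carrier_H using sym_to_cherednik_coset ncpolys_mono[OF range_subset_gens[OF that(1)]]
      by blast
  qed
  then show ?thesis
    by blast
qed

sublocale I: algebra_ideal I H
  unfolding algebra_ideal_def by (rule ring.genideal_ideal[OF ring_H invariants_in])

lemma restricted_eq: "restricted_alg G \<epsilon> R = quot_alg H I"
  by (simp add: restricted_alg_def)

lemma ring_restricted: "ring (restricted_alg G \<epsilon> R)"
  unfolding restricted_eq by (rule I.quot_alg_ring)

lemma proj_hom: "proj \<in> ring_hom (free_alg (gens G)) (restricted_alg G \<epsilon> R)"
  using ring_hom_trans[OF J.coset_hom[folded H_eq] I.coset_hom]
  unfolding restricted_eq by (simp add: comp_def proj_def[abs_def])

lemma carrier_restricted: "carrier (restricted_alg G \<epsilon> R) = proj ` ncpolys (gens G)"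
  unfolding restricted_eq carrier_quot_alg carrier_H image_image proj_def ..

lemma zero_restricted: "\<zero>\<^bsub>restricted_alg G \<epsilon> R\<^esub> = I"
  unfolding restricted_eq by (simp add: FactRing_def)

lemma proj_relation:
  assumes "r \<in> cherednik_relations G \<epsilon> R"
  shows "proj r = \<zero>\<^bsub>restricted_alg G \<epsilon> R\<^esub>"
proof -
  have "J +>\<^bsub>free_alg (gens G)\<^esub> r = \<zero>\<^bsub>H\<^esub>"
    using J.a_rcos_const[OF relation_in_J[OF assms]] unfolding H_eq by (simp add: FactRing_def)
  moreover have "I +>\<^bsub>H\<^esub> \<zero>\<^bsub>H\<^esub> = I"
    by (rule I.a_rcos_const[OF additive_subgroup.zero_closed[OF I.additive_subgroup_axioms]])
  ultimately show ?thesis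
    unfolding proj_def zero_restricted by simp
qed

text \<open>An invariant of the symmetric algebra is a coset that each group element maps onto itself. For a
  polynomial fixed by the group this holds once the action preserves the ideal \<open>K\<close>, which is
  tested on the defining relation, and once each group element acts invertibly, so that the image of the coset
  is the whole coset.\<close>

lemma proj_invariant:
  assumes Z: "Z \<in> {GX, GY}" and p: "p \<in> ncpolys (range Z)" "homogeneous d p" "d > 0"
    and fixed: "\<And>g. g \<in> G \<Longrightarrow> act g p = p"
    and rel: "\<And>g. g \<in> G \<Longrightarrow> act g (sym_rel \<epsilon> Z) \<in> K Z"
    and inv: "\<And>g. g \<in> G \<Longrightarrow> \<exists>g'\<in>G. \<forall>q\<in>ncpolys (range Z). act g (act g' q) = q"
  shows "proj p = \<zero>\<^bsub>restricted_alg G \<epsilon> R\<^esub>"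
proof -
  define C where "C = K Z +>\<^bsub>free_alg (range Z)\<^esub> p"
  interpret K: algebra_ideal "K Z" "free_alg (range Z)"
    by (rule K_ideal)
  have act_in: "act g q \<in> ncpolys (range Z)" if "q \<in> ncpolys (range Z)" for g q
    using that unfolding act_def substitute_eq_evaluate
  proof (induction q rule: ncpolys_induct)
    case (gen a q)
    then have "gen_act g a \<in> ncpolys (range Z)"
      using Z gen_act_in_ncpolys by auto
    with gen show ?case
      by (simp add: polynomials.evaluate_simps)
  qed (simp_all add: polynomials.evaluate_simps polynomials.evaluate_single)
  have K_act: "act g k \<in> K Z" if "g \<in> G" "k \<in> K Z" for g k
  proof -
    have "act g \<in> ring_hom (free_alg (range Z)) (free_alg (range Z))"
      using act_in
      by (intro ring_hom_memI)
        (auto simp: act_def substitute_eq_evaluate polynomials.evaluate_simps)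
    then interpret a: ring_hom_ring "free_alg (range Z)" "free_alg (range Z)" "act g"
      by (intro ring_hom_ringI2 ring_free_alg)
    have "K Z \<subseteq> {q \<in> ncpolys (range Z). act g q \<in> K Z}"
      using a.ideal_vimage[OF K.ideal_axioms] sym_rel_in rel[OF that(1)]
      by (intro ring.genideal_minimal[OF ring_free_alg]) auto
    with that(2) show ?thesis
      by blast
  qed
  have act_C: "act g ` C \<subseteq> C" if "g \<in> G" for g
    using K_act[OF that] fixed[OF that] unfolding C_def coset_free_alg
    by (auto simp: act_def substitute_eq_evaluate polynomials.evaluate_simps)
  have C_in: "C \<subseteq> ncpolys (range Z)"
    using K.a_Hcarr p(1) unfolding C_def coset_free_alg by auto
  have "act g ` C = C" if "g \<in> G" for g
  proof -
    obtain g' where g': "g' \<in> G" "\<And>q. q \<in> ncpolys (range Z) \<Longrightarrow> act g (act g' q) = q"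
      using inv[OF \<open>g \<in> G\<close>] by blast
    have "q \<in> act g ` C" if "q \<in> C" for q
      using g'(2)[of q] act_C[OF g'(1)] C_in that by (metis image_iff subsetD)
    with act_C[OF that] show ?thesis
      by blast
  qed
  moreover have "p \<in> C"
    unfolding C_def by (rule K.a_rcos_self[OF p(1)])
  moreover have "C \<in> carrier (sym_alg \<epsilon> Z)"
    unfolding carrier_sym_alg C_def using p(1) by blast
  ultimately have "C \<in> pos_invariants G \<epsilon> Z"
    unfolding pos_invariants_def using p(2,3) by blast
  then have "C \<in> invariant_ideal G \<epsilon> Z"
    unfolding invariant_ideal_def
    using ring.genideal_self[OF ring_sym_alg, of "pos_invariants G \<epsilon> Z" Z]
    by (auto simp: pos_invariants_def)
  then have "sym_to_cherednik G \<epsilon> R C \<in> invariants"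
    using Z by blast
  then have "J +>\<^bsub>free_alg (gens G)\<^esub> p \<in> invariants"
    unfolding C_def sym_to_cherednik_coset[OF Z p(1)] .
  then have "J +>\<^bsub>free_alg (gens G)\<^esub> p \<in> I"
    using ring.genideal_self[OF ring_H invariants_in] by blast
  then show ?thesis
    unfolding proj_def zero_restricted by (rule I.a_rcos_const)
qed

text \<open>If a coset \<open>C\<close> is invariant, then a homomorphism \<open>\<phi>\<close> that kills the relations is constant on
  \<open>C\<close>, and \<open>C\<close> contains with a homogeneous \<open>p\<close> every \<open>act g p\<close>. The last hypothesis is therefore enough
  to make \<open>\<phi>\<close> vanish on the invariants, without any description of the invariant ring.\<close>

lemma hom_factors_through_restricted:
  assumes \<phi>: "\<phi> \<in> ring_hom (free_alg (gens G)) type_ring"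
    and rel: "\<And>r. r \<in> cherednik_relations G \<epsilon> R \<Longrightarrow> \<phi> r = 0"
    and inv: "\<And>Z p d. Z \<in> {GX, GY} \<Longrightarrow> p \<in> ncpolys (range Z) \<Longrightarrow> homogeneous d p \<Longrightarrow> d > 0
      \<Longrightarrow> (\<And>g. g \<in> G \<Longrightarrow> \<phi> (act g p) = \<phi> p) \<Longrightarrow> \<phi> p = 0"
  obtains \<rho> where "\<rho> \<in> ring_hom (restricted_alg G \<epsilon> R) type_ring"
    and "\<And>p. p \<in> ncpolys (gens G) \<Longrightarrow> \<rho> (proj p) = \<phi> p"
proof -
  have "\<phi> j = 0" if "j \<in> J" for j
    using hom_vanishes_on_genideal[OF ring_free_alg \<phi> relations_in] rel that
    unfolding cherednik_ideal_def by blast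
  then obtain \<phi>' where \<phi>': "\<phi>' \<in> ring_hom H type_ring"
    "\<And>p. p \<in> ncpolys (gens G) \<Longrightarrow> \<phi>' (J +>\<^bsub>free_alg (gens G)\<^esub> p) = \<phi> p"
    unfolding H_eq by (rule J.hom_factors_through_quot_alg[OF \<phi>]) blast+
  have "\<phi>' (sym_to_cherednik G \<epsilon> R C) = 0"
    if Z: "Z \<in> {GX, GY}" and C: "C \<in> invariant_ideal G \<epsilon> Z" for Z C
  proof -
    note sub = ncpolys_mono[OF range_subset_gens[OF Z]]
    interpret K: algebra_ideal "K Z" "free_alg (range Z)"
      by (rule K_ideal)
    have \<phi>Z: "\<phi> \<in> ring_hom (free_alg (range Z)) type_ring"
      using sub ring_hom_mult[OF \<phi>] ring_hom_add[OF \<phi>] ring_hom_one[OF \<phi>]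
      by (intro ring_hom_memI) (auto simp: subset_iff)
    have K0: "\<phi> k = 0" if "k \<in> K Z" for k
      using \<open>\<And>j. j \<in> J \<Longrightarrow> \<phi> j = 0\<close> K_subset_J[OF Z] that by blast
    from K0 obtain \<psi> where \<psi>: "\<psi> \<in> ring_hom (sym_alg \<epsilon> Z) type_ring"
      "\<And>p. p \<in> ncpolys (range Z) \<Longrightarrow> \<psi> (K Z +>\<^bsub>free_alg (range Z)\<^esub> p) = \<phi> p"
      unfolding sym_alg_eq by (rule K.hom_factors_through_quot_alg[OF \<phi>Z]) blast+
    have "\<psi> D = 0" if D: "D \<in> pos_invariants G \<epsilon> Z" for D
    proof -
      have "D \<in> carrier (sym_alg \<epsilon> Z)"
        using D by (simp add: pos_invariants_def)
      then obtain q where q: "q \<in> ncpolys (range Z)" "D = K Z +>\<^bsub>free_alg (range Z)\<^esub> q"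
        unfolding carrier_sym_alg by blast
      have const: "\<phi> p = \<psi> D" if "p \<in> D" for p
        using K.hom_const_on_coset[OF \<phi>Z K0 q(1)] that \<psi>(2)[OF q(1)] q(2) by simp
      obtain d p where p: "d > 0" "p \<in> D" "homogeneous d p" and fixed: "\<And>g. g \<in> G \<Longrightarrow> act g ` D = D"
        using D unfolding pos_invariants_def by blast
      have "p \<in> ncpolys (range Z)"
        using p(2) q K.a_Hcarr unfolding coset_free_alg by auto
      moreover have "\<phi> (act g p) = \<phi> p" if "g \<in> G" for g
        using const fixed[OF that] p(2) by (metis imageI)
      ultimately have "\<phi> p = 0"
        by (intro inv[OF Z _ p(3,1)])
      with const[OF p(2)] show ?thesis
        by simp
    qed
    then have "\<psi> C = 0"
      using hom_vanishes_on_genideal[OF ring_sym_alg \<psi>(1), of "pos_invariants G \<epsilon> Z" C] C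
      unfolding invariant_ideal_def by (auto simp: pos_invariants_def)
    moreover obtain p where p: "p \<in> ncpolys (range Z)" "C = K Z +>\<^bsub>free_alg (range Z)\<^esub> p"
      using ideal.Icarr[OF invariant_ideal_is_ideal C] unfolding carrier_sym_alg by blast
    ultimately have "\<phi> p = 0"
      using \<psi>(2) by simp
    moreover have "p \<in> ncpolys (gens G)"
      using sub p(1) by blast
    ultimately show ?thesis
      unfolding p(2) sym_to_cherednik_coset[OF Z p(1)] using \<phi>'(2) by simp
  qed
  then have "\<phi>' D = 0" if "D \<in> invariants" for D
    using that by blast
  then have "\<phi>' D = 0" if "D \<in> I" for D
    using hom_vanishes_on_genideal[OF ring_H \<phi>'(1) invariants_in _ that] by blast
  then obtain \<rho> where \<rho>: "\<rho> \<in> ring_hom (restricted_alg G \<epsilon> R) type_ring"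
    "\<And>D. D \<in> carrier H \<Longrightarrow> \<rho> (I +>\<^bsub>H\<^esub> D) = \<phi>' D"
    unfolding restricted_eq by (rule I.hom_factors_through_quot_alg[OF \<phi>'(1)]) blast+
  show thesis
  proof (rule that[OF \<rho>(1)])
    fix p assume "p \<in> ncpolys (gens G)"
    then show "\<rho> (proj p) = \<phi> p"
      unfolding proj_def using \<rho>(2)[of "J +>\<^bsub>free_alg (gens G)\<^esub> p"] \<phi>'(2)
      by (simp add: carrier_H)
  qed
qed

end

section \<open>Orthogonal matrices acting on the generators\<close>

lemma matrix_inv_eqI:
  fixes g h :: "'a::semiring_1^'n^'n"
  assumes "g ** h = mat 1" "h ** g = mat 1"
  shows "matrix_inv g = h"
proof -
  have "g ** matrix_inv g = mat 1 \<and> matrix_inv g ** g = mat 1"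
    unfolding matrix_inv_def by (rule someI[of _ h]) (use assms in simp)
  then show ?thesis
    by (metis assms(2) matrix_mul_assoc matrix_mul_lid matrix_mul_rid)
qed

definition orthogonal_mat :: "rat^2^2 \<Rightarrow> bool" where
  "orthogonal_mat g \<longleftrightarrow> g ** transpose g = mat 1 \<and> transpose g ** g = mat 1"

lemmas mat2_simps = vec_eq_iff forall_2 matrix_matrix_mult_def sum_2 mat_def transpose_def

lemma matrix_inv_orthogonal: "orthogonal_mat g \<Longrightarrow> matrix_inv g = transpose g"
  unfolding orthogonal_mat_def by (rule matrix_inv_eqI) auto

lemma gen_act_orthogonal:
  "gen_act g (GX i) = scale (g $ 1 $ i) (gx 1) + scale (g $ 2 $ i) (gx 2)"
  "orthogonal_mat g \<Longrightarrow> gen_act g (GY i) = scale (g $ 1 $ i) (gy 1) + scale (g $ 2 $ i) (gy 2)"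
  using exhaust_2[of i]
  by (auto simp: sum_2 matrix_vector_mult_def axis_def matrix_inv_orthogonal)

declare gen_act.simps [simp del]

section \<open>Lowest weight theory in type \<open>A\<^sub>1 \<times> A\<^sub>1\<close>\<close>

lemma span_mult_closed:
  fixes w :: "'r::real_algebra_1"
  assumes "\<And>m. m \<in> B \<Longrightarrow> w * m \<in> span B" "m \<in> span B"
  shows "w * m \<in> span B"
  using assms(2)
proof (induction rule: span_induct_alt)
  case (step c x y)
  then show ?case
    using assms(1) by (simp add: distrib_left span_add span_scale)
qed (simp add: span_zero)

text \<open>Since G(2,2,2) has type \<open>A\<^sub>1 \<times> A\<^sub>1\<close>, the coordinates \<open>u = x\<^sub>1 - x\<^sub>2\<close>, \<open>v = x\<^sub>1 + x\<^sub>2\<close>,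
  \<open>a = y\<^sub>1 - y\<^sub>2\<close>, \<open>b = y\<^sub>1 + y\<^sub>2\<close> split its Cherednik algebra into two commuting rank one algebras,
  generated by \<open>u, a, S\<close> and by \<open>v, b, T\<close>. The squares \<open>u\<^sup>2\<close>, \<open>v\<^sup>2\<close>, \<open>a\<^sup>2\<close>, \<open>b\<^sup>2\<close> are the basic
  invariants, which vanish in the restricted algebra. The relations are oriented as rewrite rules
  towards the order \<open>u, v, S, T, a, b\<close> of a PBW basis.\<close>

locale cherednik_A1_A1 =
  fixes u v a b S T :: "'r::real_algebra_1"
  assumes squares: "u * u = 0" "v * v = 0" "a * a = 0" "b * b = 0" "S * S = 1" "T * T = 1"
    and commute: "v * u = u * v" "b * a = a * b" "T * S = S * T"
      "a * v = v * a" "b * u = u * b"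
      "S * v = v * S" "T * u = u * T" "b * S = S * b" "a * T = T * a"
    and anticommute: "S * u = - (u * S)" "a * S = - (S * a)" "T * v = - (v * T)" "b * T = - (T * b)"
    and cross: "a * u = u * a - 4 *\<^sub>R S" "b * v = v * b - 4 *\<^sub>R T"
begin

text \<open>With products nested to the right, a rule must also apply in front of a further factor \<open>x\<close>.\<close>

lemma reorder:
  "u * (u * x) = 0" "v * (v * x) = 0" "a * (a * x) = 0" "b * (b * x) = 0"
  "S * (S * x) = x" "T * (T * x) = x"
  "v * (u * x) = u * (v * x)" "b * (a * x) = a * (b * x)" "T * (S * x) = S * (T * x)"
  "a * (v * x) = v * (a * x)" "b * (u * x) = u * (b * x)"
  "S * (v * x) = v * (S * x)" "T * (u * x) = u * (T * x)"
  "b * (S * x) = S * (b * x)" "a * (T * x) = T * (a * x)"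
  "S * (u * x) = - (u * (S * x))" "a * (S * x) = - (S * (a * x))"
  "T * (v * x) = - (v * (T * x))" "b * (T * x) = - (T * (b * x))"
  "a * (u * x) = u * (a * x) - 4 *\<^sub>R (S * x)" "b * (v * x) = v * (b * x) - 4 *\<^sub>R (T * x)"
  by (simp_all add: mult.assoc[symmetric] squares commute anticommute cross left_diff_distrib)

lemmas normalise = mult.assoc squares commute anticommute cross reorder
  distrib_left distrib_right left_diff_distrib right_diff_distrib scaleR_add_right
  scaleR_diff_right

text \<open>\<open>E\<close> acts on a Verma module as a multiple of the projection onto its lowest weight vectors:
  \<open>E * u = E * v = 0\<close>, while \<open>a * u\<close> and \<open>b * v\<close> act on vectors killed by \<open>a\<close> and \<open>b\<close> as
  \<open>- 4 S\<close> and \<open>- 4 T\<close>.\<close>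

definition E :: 'r where "E = a * u * (b * v)"

text \<open>If \<open>a\<close> and \<open>b\<close> kill \<open>p\<close> and \<open>S\<close>, \<open>T\<close> act on \<open>p\<close> by scalars, this is the module generated by
  \<open>p\<close>, a quotient of a Verma module.\<close>

definition verma :: "'r \<Rightarrow> 'r set" where
  "verma p = span {p, u * p, v * p, u * (v * p)}"

text \<open>The ideal generated by \<open>E\<close> contains \<open>16 S T = (a u - u a) (b v - v b)\<close>, hence 1. Expanding the
  product gives four terms: \<open>E\<close> itself and three that are obtained from \<open>E\<close> by multiplying with
  \<open>u\<close> and \<open>a\<close>, or \<open>v\<close> and \<open>b\<close>, or all of them, because for instance \<open>u (a u) a = - 4 u S a = 4 S u a\<close>.\<close>

lemma E_nonzero: "E \<noteq> 0"
proof
  assume "E = 0"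
  have "16 *\<^sub>R (S * T) = E - (1/4) *\<^sub>R (S * u * E * a) - (1/4) *\<^sub>R (T * v * E * b)
      + (1/16) *\<^sub>R (S * T * u * v * E * a * b)"
    unfolding E_def by (simp add: normalise)
  with \<open>E = 0\<close> have "S * T = 0"
    by simp
  then have "S * (S * T) * T = 0"
    by simp
  then show False
    by (simp add: normalise)
qed

context
  fixes p :: 'r and \<epsilon> \<delta> :: real
  assumes singular: "a * p = 0" "b * p = 0" "S * p = \<epsilon> *\<^sub>R p" "T * p = \<delta> *\<^sub>R p"
begin

lemma generators_preserve_verma:
  assumes "w \<in> {u, v, a, b, S, T}" "m \<in> verma p"
  shows "w * m \<in> verma p"
  using assms(2) unfolding verma_def
proof (rule span_mult_closed[rotated])
  fix m assume "m \<in> {p, u * p, v * p, u * (v * p)}"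
  with assms(1) show "w * m \<in> span {p, u * p, v * p, u * (v * p)}"
    by (auto simp: normalise singular intro!: span_zero span_neg span_scale intro: span_base)
qed

lemma E_verma:
  assumes "m \<in> verma p"
  shows "\<exists>r. E * m = r *\<^sub>R p"
proof -
  have "E * m \<in> span {p}"
    using assms unfolding verma_def
  proof (induction rule: span_induct_alt)
    case (step c x y)
    have "E * x \<in> span {p}"
      using step.hyps
      by (auto simp: E_def normalise singular mult.commute[of \<delta> \<epsilon>] intro!: span_zero span_neg span_scale intro: span_base)
    with step show ?case
      by (simp add: distrib_left span_add span_scale)
  qed (simp add: span_zero)
  then show ?thesis
    by (auto simp: span_singleton)
qed

lemma E_singular: "E * p = (16 * \<epsilon> * \<delta>) *\<^sub>R p"
  by (simp add: E_def normalise singular mult.commute[of \<delta> \<epsilon>])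

text \<open>\<open>j * p\<close> lies in the Verma module, where \<open>E\<close> projects onto the line of \<open>p\<close>. Since \<open>j\<close> commutes with
  \<open>E\<close>, it maps \<open>p\<close> to a real multiple of \<open>p\<close>, and no real number has square -1.\<close>

lemma singular_trivial:
  assumes j: "j * E = E * j" "j * j = - 1" and "j * p \<in> verma p"
    and "\<epsilon> \<noteq> 0" "\<delta> \<noteq> 0"
  shows "p = 0"
proof -
  obtain r where "E * (j * p) = r *\<^sub>R p"
    using E_verma assms(3) by blast
  moreover have "E * (j * p) = j * (E * p)"
    by (simp add: j(1) mult.assoc[symmetric])
  ultimately have "(16 * \<epsilon> * \<delta>) *\<^sub>R (j * p) = r *\<^sub>R p"
    by (simp add: E_singular)
  moreover have "j * p = inverse (16 * \<epsilon> * \<delta>) *\<^sub>R (16 * \<epsilon> * \<delta>) *\<^sub>R (j * p)"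
    unfolding scaleR_scaleR using assms(4,5) by (subst left_inverse) auto
  ultimately obtain t where Jp: "j * p = t *\<^sub>R p"
    by (metis scaleR_scaleR)
  have "- p = j * (j * p)"
    by (simp add: j(2) mult.assoc[symmetric])
  also have "\<dots> = t\<^sup>2 *\<^sub>R p"
    unfolding Jp mult_scaleR_right scaleR_scaleR power2_eq_square ..
  finally have "(1 + t\<^sup>2) *\<^sub>R p = 0"
    unfolding scaleR_add_left by (simp add: add_eq_0_iff)
  moreover have "1 + t\<^sup>2 \<noteq> 0"
    using zero_le_power2[of t] by linarith
  ultimately show "p = 0"
    by simp
qed

end

text \<open>The last hypothesis holds for every \<open>j\<close> in the real subalgebra generated by
  \<open>u, v, a, b, S, T\<close>. The four elements \<open>(1 \<plusminus> S) (1 \<plusminus> T) E\<close> are lowest weight vectors for the four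
  characters of the group, so they would all vanish by \<open>singular_trivial\<close>. Their sum is \<open>4 E\<close>, which is not 0.\<close>

theorem no_imaginary_unit:
  assumes j: "j * E = E * j" "j * j = - 1"
    and generated: "\<And>p. (\<And>w m. w \<in> {u, v, a, b, S, T} \<Longrightarrow> m \<in> verma p \<Longrightarrow> w * m \<in> verma p)
      \<Longrightarrow> j * p \<in> verma p"
  shows False
proof -
  have zero: "(1 + \<epsilon> *\<^sub>R S) * (1 + \<delta> *\<^sub>R T) * E = 0" (is "?p = 0")
    if \<epsilon>: "\<epsilon> = 1 \<or> \<epsilon> = -1" and \<delta>: "\<delta> = 1 \<or> \<delta> = -1" for \<epsilon> \<delta> :: real
  proof -
    have sing: "a * ?p = 0" "b * ?p = 0" "S * ?p = \<epsilon> *\<^sub>R ?p" "T * ?p = \<delta> *\<^sub>R ?p"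
      using \<epsilon> \<delta> by (auto simp: E_def normalise)
    have "j * ?p \<in> verma ?p"
      by (rule generated) (rule generators_preserve_verma[OF sing])
    with \<epsilon> \<delta> show "?p = 0"
      by (intro singular_trivial[OF sing j]) auto
  qed
  have "4 *\<^sub>R E = (1 + 1 *\<^sub>R S) * (1 + 1 *\<^sub>R T) * E + (1 + 1 *\<^sub>R S) * (1 + (-1) *\<^sub>R T) * E
      + (1 + (-1) *\<^sub>R S) * (1 + 1 *\<^sub>R T) * E + (1 + (-1) *\<^sub>R S) * (1 + (-1) *\<^sub>R T) * E"
    using scaleR_add_left[of 2 2 E] scaleR_add_left[of 1 1 E] by (simp add: algebra_simps)
  also have "\<dots> = 0"
    by (simp only: zero simp_thms add_0_left)
  finally show ?thesis
    using E_nonzero by simp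
qed

end

section \<open>The restricted Cherednik algebra of G(2,2,2)\<close>

lemma homogeneous_closed:
  "homogeneous (Suc 0) (var a)"
  "homogeneous d p \<Longrightarrow> homogeneous e q \<Longrightarrow> homogeneous (d + e) (p * q)"
  "homogeneous d p \<Longrightarrow> homogeneous d q \<Longrightarrow> homogeneous d (p + q)"
  "homogeneous d p \<Longrightarrow> homogeneous d (- p)"
proof -
  show "homogeneous (Suc 0) (var a)"
    by (simp add: homogeneous_def var_def)
  show "homogeneous (d + e) (p * q)" if "homogeneous d p" "homogeneous e q"
    unfolding homogeneous_def
  proof
    fix w assume "w \<in> Poly_Mapping.keys (p * q)"
    then obtain v v' where "v \<in> Poly_Mapping.keys p" "v' \<in> Poly_Mapping.keys q" "w = v + v'"
      using keys_mult[of p q] by blast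
    with that show "length w = d + e"
      by (simp add: homogeneous_def plus_list_def)
  qed
  show "homogeneous d (p + q)" if "homogeneous d p" "homogeneous d q"
    using that keys_add[of p q] unfolding homogeneous_def by blast
  show "homogeneous d (- p)" if "homogeneous d p"
    using that by (simp add: homogeneous_def in_keys_iff)
qed

lemma scale_simps [simp]: "scale 0 p = 0" "scale 1 p = p" "scale (- 1) p = - p"
  using mult_minus_left[of 1 p] by (simp_all add: scale_eq_mult single_uminus)

lemma s_mat_nth [simp]:
  "s_mat $ 1 $ 1 = 0" "s_mat $ 1 $ 2 = 1" "s_mat $ 2 $ 1 = 1" "s_mat $ 2 $ 2 = 0"
  "sbar_mat $ 1 $ 1 = 0" "sbar_mat $ 1 $ 2 = - 1" "sbar_mat $ 2 $ 1 = - 1" "sbar_mat $ 2 $ 2 = 0"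
  by (simp_all add: s_mat_def sbar_mat_def)

lemma G222_mult:
  "s_mat ** s_mat = mat 1" "sbar_mat ** sbar_mat = mat 1" "sbar_mat ** s_mat = s_mat ** sbar_mat"
  "s_mat ** sbar_mat = - mat 1"
  by (simp_all add: mat2_simps)

lemma G222_eq: "G222 = {mat 1, s_mat, sbar_mat, - mat 1}"
  by (simp add: G222_def G222_mult)

lemma uminus_mat_1 [simp]: "(- mat 1) ** g = - (g :: rat^2^2)" "g ** (- mat 1) = - (g :: rat^2^2)"
  "- s_mat = sbar_mat" "- sbar_mat = s_mat"
  by (simp_all add: mat2_simps)

lemma cherednik_G222: "cherednik G222 (G222_relations c)"
proof (rule cherednik.intro)
  show "mat 1 \<in> G222"
    by (simp add: G222_def)
  show "g ** h \<in> G222" if "g \<in> G222" "h \<in> G222" for g h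
    using that by (auto simp: G222_eq G222_mult)
  show "G222_relations c \<subseteq> ncpolys (gens G222)"
    by (auto simp: G222_relations_def gens_def G222_def)
qed

lemma orthogonal_G222: "g \<in> G222 \<Longrightarrow> orthogonal_mat g"
  by (auto simp: G222_eq orthogonal_mat_def mat2_simps)

text \<open>Every check on the action reduces through this form to a sign and a swap, for V and its dual at once.\<close>

lemma gen_act_G222:
  assumes "g \<in> G222" "Z \<in> {GX, GY}"
  shows "\<exists>e\<in>{1, - 1}. gen_act g (Z 1) = e * var (Z 1) \<and> gen_act g (Z 2) = e * var (Z 2) \<or>
    gen_act g (Z 1) = e * var (Z 2) \<and> gen_act g (Z 2) = e * var (Z 1)"
  using assms orthogonal_G222[OF assms(1)]
  by (auto simp: G222_eq gen_act_orthogonal mat_def)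

lemmas act_simps = polynomials.evaluate_simps[where h = "gen_act g" for g,
  folded substitute_eq_evaluate, folded act_def]

text \<open>Each group element maps \<open>x\<^sub>1 \<plusminus> x\<^sub>2\<close> to plus or minus itself, so the square is invariant already as a
  noncommutative polynomial.\<close>

lemma proj_square:
  assumes Z: "Z \<in> {GX, GY}" and e: "e \<in> {1, - 1}"
  shows "cherednik.proj G222 1 (G222_relations c)
    ((var (Z 1) + e * var (Z 2)) * (var (Z 1) + e * var (Z 2))) =
    \<zero>\<^bsub>restricted_alg G222 1 (G222_relations c)\<^esub>" (is "cherednik.proj _ _ _ ?p = _")
proof (rule cherednik.proj_invariant[OF cherednik_G222 Z, where d = 2])
  show "?p \<in> ncpolys (range Z)"
    using e by auto
  have "homogeneous (1 + 1) ?p"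
    using e by (intro homogeneous_closed(2,3)) (auto intro!: homogeneous_closed(1,4))
  then show "homogeneous 2 ?p"
    by (simp only: one_add_one)
next
  fix g assume g: "g \<in> G222"
  show "act g ?p = ?p"
    using gen_act_G222[OF g Z] e by (auto simp: act_simps algebra_simps)
  interpret K: ideal "genideal (free_alg (range Z)) {sym_rel 1 Z}" "free_alg (range Z)"
    by (rule ring.genideal_ideal[OF ring_free_alg]) (simp add: sym_rel_def)
  have "sym_rel 1 Z \<in> genideal (free_alg (range Z)) {sym_rel 1 Z}"
    by (rule ring.genideal_self'[OF ring_free_alg]) (simp add: sym_rel_def)
  moreover from this have "- 1 * sym_rel 1 Z \<in> genideal (free_alg (range Z)) {sym_rel 1 Z}"
    using K.I_l_closed[of "sym_rel 1 Z" "- 1"] by simp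
  moreover have "act g (sym_rel 1 Z) \<in> {sym_rel 1 Z, - 1 * sym_rel 1 Z}"
    using gen_act_G222[OF g Z] by (auto simp: sym_rel_def act_simps)
  ultimately show "act g (sym_rel 1 Z) \<in> genideal (free_alg (range Z)) {sym_rel 1 Z}"
    by auto
  have gen: "act g (gen_act g (Z i)) = var (Z i)" for i
    using gen_act_G222[OF g Z] exhaust_2[of i] by (auto simp: act_simps)
  have "act g (act g q) = q" if "q \<in> ncpolys (range Z)" for q
    using that
  proof (induction q rule: ncpolys_induct)
    case (const q)
    then show ?case
      by (simp add: act_def substitute_eq_evaluate polynomials.evaluate_single)
  qed (auto simp: act_simps gen)
  with g show "\<exists>g'\<in>G222. \<forall>q\<in>ncpolys (range Z). act g (act g' q) = q"
    by blast
qed simp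

lemma cherednik_A1_A1_of_relations:
  fixes X1 X2 Y1 Y2 S T :: "'r::real_algebra_1"
  assumes comm: "X2 * X1 = X1 * X2" "Y2 * Y1 = Y1 * Y2"
    and grp: "S * S = 1" "T * T = 1" "T * S = S * T"
    and SX: "S * X1 = X2 * S" "S * X2 = X1 * S" "T * X1 = - (X2 * T)" "T * X2 = - (X1 * T)"
    and SY: "Y1 * S = S * Y2" "Y2 * S = S * Y1" "Y1 * T = - (T * Y2)" "Y2 * T = - (T * Y1)"
    and YX: "Y1 * X2 = X2 * Y1 + (S - T)" "Y2 * X1 = X1 * Y2 + (S - T)"
      "Y1 * X1 = X1 * Y1 - (S + T)" "Y2 * X2 = X2 * Y2 - (S + T)"
    and sq: "(X1 - X2) * (X1 - X2) = 0" "(X1 + X2) * (X1 + X2) = 0"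
      "(Y1 - Y2) * (Y1 - Y2) = 0" "(Y1 + Y2) * (Y1 + Y2) = 0"
  shows "cherednik_A1_A1 (X1 - X2) (X1 + X2) (Y1 - Y2) (Y1 + Y2) S T"
proof -
  have four: "4 *\<^sub>R x = x + x + x + x" for x :: 'r
    using scaleR_add_left[of 2 2 x] by (simp add: scaleR_2)
  show ?thesis
    by standard (rule sq | simp add: comm grp SX SY YX four distrib_left distrib_right
      left_diff_distrib right_diff_distrib)+
qed

text \<open>The image of the algebra satisfies the relations of type \<open>A\<^sub>1 \<times> A\<^sub>1\<close>, and each of its elements is a
  rational polynomial in the generators. Lowest weight theory over the reals then excludes an imaginary unit that
  commutes with the image.\<close>

theorem restricted_G222_no_imaginary_unit:
  fixes \<psi> :: "gen ncpoly set set \<Rightarrow> 'r::real_algebra_1"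
  assumes \<psi>: "\<psi> \<in> ring_hom (restricted_cherednik_G222 1) type_ring"
    and j: "j \<in> \<psi> ` carrier (restricted_cherednik_G222 1)" "j * j = - 1"
    and central: "\<And>x. x \<in> carrier (restricted_cherednik_G222 1) \<Longrightarrow> j * \<psi> x = \<psi> x * j"
  shows False
proof -
  define R where "R = G222_relations 1"
  note G = cherednik_G222[of 1, folded R_def]
  define \<pi> where "\<pi> = cherednik.proj G222 1 R"
  have B: "restricted_cherednik_G222 1 = restricted_alg G222 1 R"
    by (simp add: restricted_cherednik_G222_def R_def)
  have carrier: "carrier (restricted_cherednik_G222 1) = \<pi> ` ncpolys (gens G222)"
    unfolding B \<pi>_def by (rule cherednik.carrier_restricted[OF G])
  define \<phi> where "\<phi> p = \<psi> (\<pi> p)" for p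
  have \<phi>: "\<phi> \<in> ring_hom (free_alg (gens G222)) type_ring"
    using ring_hom_trans[OF cherednik.proj_hom[OF G] \<psi>[unfolded B]]
    by (simp add: comp_def \<phi>_def[abs_def] \<pi>_def)
  interpret central_scalars "\<lambda>q. of_real (of_rat q) :: 'r"
    by (rule real_algebra_scalars)
  define ev where "ev = evaluate (\<lambda>q. of_real (of_rat q) :: 'r) (\<lambda>a. \<phi> (var a))"
  note ev_simps = evaluate_simps[where h = "\<lambda>a. \<phi> (var a)", folded ev_def]
  have \<phi>_eq: "\<phi> p = ev p" if "p \<in> ncpolys (gens G222)" for p
    unfolding ev_def by (rule type_hom_eq_evaluate[OF \<phi> that])
  have ev_0: "ev p = 0" if "p \<in> ncpolys (gens G222)" "\<pi> p = \<zero>\<^bsub>restricted_alg G222 1 R\<^esub>" for p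
    using \<phi>_eq[OF that(1)] type_hom_0[OF cherednik.ring_restricted[OF G] \<psi>[unfolded B]] that(2)
    by (simp add: \<phi>_def)
  have rel: "ev r = 0" if "r \<in> cherednik_relations G222 1 R" for r
    using ev_0 cherednik.relations_in[OF G] cherednik.proj_relation[OF G that] that
    unfolding \<pi>_def by blast
  define X1 X2 Y1 Y2 where
    "X1 = \<phi> (gx 1)" "X2 = \<phi> (gx 2)" "Y1 = \<phi> (gy 1)" "Y2 = \<phi> (gy 2)"
  define \<gamma> where "\<gamma> g = \<phi> (grp g)" for g
  note names = X1_X2_Y1_Y2_def[symmetric] \<gamma>_def[symmetric]
  have gamma_1: "\<gamma> (mat 1) = 1"
    using rel[of "grp (mat 1) - 1"] by (simp add: cherednik_relations_def ev_simps names)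
  have gamma_mult: "\<gamma> g * \<gamma> h = \<gamma> (g ** h)" if "g \<in> G222" "h \<in> G222" for g h
  proof -
    have "grp g * grp h - grp (g ** h) \<in> cherednik_relations G222 1 R"
      using that unfolding cherednik_relations_def by blast
    from rel[OF this] show ?thesis
      by (simp add: ev_simps names)
  qed
  have sym: "ev (sym_rel 1 GX) = 0" "ev (sym_rel 1 GY) = 0"
    by (intro rel; simp add: cherednik_relations_def)+
  have act_x: "\<gamma> g * ev (gx i) = ev (gen_act g (GX i)) * \<gamma> g" if "g \<in> G222" for g i
  proof -
    have "grp g * gx i - act g (gx i) * grp g \<in> cherednik_relations G222 1 R"
      using that unfolding cherednik_relations_def by blast
    from rel[OF this] show ?thesis
      by (simp add: ev_simps names)
  qed
  have act_y: "\<gamma> g * ev (gy i) = ev (gen_act g (GY i)) * \<gamma> g" if "g \<in> G222" for g i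
  proof -
    have "grp g * gy i - act g (gy i) * grp g \<in> cherednik_relations G222 1 R"
      using that unfolding cherednik_relations_def by blast
    from rel[OF this] show ?thesis
      by (simp add: ev_simps names)
  qed
  have yx: "ev (gy i * gx j - gx j * gy i - scale 1 (grp s_mat - grp sbar_mat)) = 0" if "i \<noteq> j" for i j
    using that by (intro rel) (auto simp: cherednik_relations_def R_def G222_relations_def)
  have yx': "ev (gy i * gx i - gx i * gy i - scale (- 1) (grp s_mat + grp sbar_mat)) = 0" for i
    by (intro rel) (auto simp: cherednik_relations_def R_def G222_relations_def)
  have square: "ev ((var (Z 1) + e * var (Z 2)) * (var (Z 1) + e * var (Z 2))) = 0"
    if "Z \<in> {GX, GY}" "e \<in> {1, - 1}" for Z :: "2 \<Rightarrow> gen" and e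
    using that
    by (intro ev_0) (auto simp: gens_def proj_square[OF that, of 1, folded R_def] \<pi>_def)
  have in_G: "s_mat \<in> G222" "sbar_mat \<in> G222"
    by (simp_all add: G222_def)
  note orth = in_G[THEN orthogonal_G222]
  let ?S = "\<gamma> s_mat" and ?T = "\<gamma> sbar_mat"
  interpret cherednik_A1_A1 "X1 - X2" "X1 + X2" "Y1 - Y2" "Y1 + Y2" ?S ?T
  proof (rule cherednik_A1_A1_of_relations)
    show "X2 * X1 = X1 * X2" "Y2 * Y1 = Y1 * Y2"
      using sym by (simp_all add: sym_rel_def ev_simps names)
    show "?S * ?S = 1" "?T * ?T = 1" "?T * ?S = ?S * ?T"
      by (simp_all add: gamma_mult in_G G222_mult gamma_1)
    show "?S * X1 = X2 * ?S" "?S * X2 = X1 * ?S" "?T * X1 = - (X2 * ?T)" "?T * X2 = - (X1 * ?T)"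
      using act_x[OF in_G(1), of 1] act_x[OF in_G(1), of 2] act_x[OF in_G(2), of 1]
        act_x[OF in_G(2), of 2]
      by (simp_all add: gen_act_orthogonal ev_simps names)
    show "Y1 * ?S = ?S * Y2" "Y2 * ?S = ?S * Y1" "Y1 * ?T = - (?T * Y2)" "Y2 * ?T = - (?T * Y1)"
      using act_y[OF in_G(1), of 1] act_y[OF in_G(1), of 2] act_y[OF in_G(2), of 1]
        act_y[OF in_G(2), of 2] orth
      by (simp_all add: gen_act_orthogonal ev_simps names)
    show "Y1 * X2 = X2 * Y1 + (?S - ?T)" "Y2 * X1 = X1 * Y2 + (?S - ?T)"
      using yx[of 1 2] yx[of 2 1] by (simp_all add: ev_simps names algebra_simps)
    show "Y1 * X1 = X1 * Y1 - (?S + ?T)" "Y2 * X2 = X2 * Y2 - (?S + ?T)"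
      using yx'[of 1] yx'[of 2] by (simp_all add: ev_simps names algebra_simps)
    show "(X1 - X2) * (X1 - X2) = 0" "(X1 + X2) * (X1 + X2) = 0"
      "(Y1 - Y2) * (Y1 - Y2) = 0" "(Y1 + Y2) * (Y1 + Y2) = 0"
      using square[of GX "- 1"] square[of GX 1] square[of GY "- 1"] square[of GY 1]
      by (simp_all add: ev_simps names)
  qed
  obtain w where w: "w \<in> ncpolys (gens G222)" "j = \<phi> w"
    using j(1) unfolding carrier \<phi>_def by blast
  show False
  proof (rule no_imaginary_unit)
    show "j * j = - 1"
      by (rule j(2))
    let ?e = "(gy 1 - gy 2) * (gx 1 - gx 2) * ((gy 1 + gy 2) * (gx 1 + gx 2))"
    have e: "?e \<in> ncpolys (gens G222)"
      by (simp add: gens_def)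
    then have "E = \<psi> (\<pi> ?e)"
      using \<phi>_eq[OF e] by (simp add: E_def ev_simps names \<phi>_def[symmetric])
    then show "j * E = E * j"
      using central[of "\<pi> ?e"] e unfolding carrier by simp
  next
    fix p
    assume closed: "\<And>x m. x \<in> {X1 - X2, X1 + X2, Y1 - Y2, Y1 + Y2, ?S, ?T} \<Longrightarrow> m \<in> verma p
      \<Longrightarrow> x * m \<in> verma p"
    have sub: "subspace (verma p)"
      unfolding verma_def by (rule subspace_span)
    have scale: "c *\<^sub>R m \<in> verma p" if "m \<in> verma p" for c m
      using subspace_scale[OF sub that] .
    \<comment> \<open>\<open>x\<^sub>1\<close> and \<open>x\<^sub>2\<close> are recovered from \<open>u = x\<^sub>1 - x\<^sub>2\<close> and \<open>v = x\<^sub>1 + x\<^sub>2\<close>, and likewise for the \<open>y\<^sub>i\<close>.\<close>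
    have half: "x * m \<in> verma p"
      if "(x + y) * m \<in> verma p" "(x - y) * m \<in> verma p" for x y m :: 'r
    proof -
      have "x * m = (1/2) *\<^sub>R ((x + y) * m + (x - y) * m)"
        by (simp add: distrib_right left_diff_distrib scaleR_2[symmetric])
      then show ?thesis
        using scale[OF subspace_add[OF sub that]] by metis
    qed
    have half': "y * m \<in> verma p"
      if "(x + y) * m \<in> verma p" "(x - y) * m \<in> verma p" for x y m :: 'r
      using half[of y x m] that scale[OF that(2), of "- 1"]
      by (simp add: add.commute left_diff_distrib)
    have gens: "\<phi> (var a) * m \<in> verma p" if a: "a \<in> gens G222" and m: "m \<in> verma p" for a m
    proof -
      have X: "X1 * m \<in> verma p" "X2 * m \<in> verma p" "Y1 * m \<in> verma p" "Y2 * m \<in> verma p"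
        using half[of X1 X2 m] half'[of X1 X2 m] half[of Y1 Y2 m] half'[of Y1 Y2 m] closed m
        by auto
      have "\<gamma> (s_mat ** sbar_mat) * m \<in> verma p"
        using closed m by (simp add: gamma_mult[OF in_G, symmetric] mult.assoc)
      then have \<gamma>: "\<gamma> g * m \<in> verma p" if "g \<in> G222" for g
        using that closed m gamma_1 by (auto simp: G222_def)
      show ?thesis
        using a
      proof (cases a)
        case (GX i)
        then show ?thesis using X exhaust_2[of i] by (auto simp: names)
      next
        case (GY i)
        then show ?thesis using X exhaust_2[of i] by (auto simp: names)
      next
        case (GG g)
        then show ?thesis using \<gamma> a by (auto simp: names gens_def)
      qed
    qed
    have "ev w * m \<in> verma p" if "m \<in> verma p" for m
      using w(1) that
    proof (induction w arbitrary: m rule: ncpolys_induct)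
      case (const q)
      then show ?case
        by (simp add: ev_def evaluate_single scaleR_conv_of_real[symmetric] scale)
    next
      case (gen a q)
      then show ?case
        by (simp add: ev_simps mult.assoc gens)
    next
      case (add q r)
      then show ?case
        by (simp add: ev_simps distrib_right subspace_add[OF sub])
    qed
    moreover have "p \<in> verma p"
      unfolding verma_def by (rule span_base) simp
    ultimately show "j * p \<in> verma p"
      unfolding w(2) \<phi>_eq[OF w(1)] by blast
  qed
qed

section \<open>Linear endomorphisms as a real algebra\<close>

text \<open>As a type of class \<^class>\<open>real_algebra_1\<close>, endomorphisms can serve as the target of a
  representation to which the exclusion of imaginary units applies.\<close>

typedef (overloaded) 'v endo = "{f :: 'v::euclidean_space \<Rightarrow> 'v. linear f}"
  morphisms apply_endo Endo
  by (intro exI[of _ id]) (simp add: id_def linear_iff)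

setup_lifting type_definition_endo

instantiation endo :: (euclidean_space) real_algebra_1
begin

lift_definition zero_endo :: "'a endo" is "\<lambda>_. 0" by (simp add: linear_iff)
lift_definition one_endo :: "'a endo" is "\<lambda>v. v" by (simp add: linear_iff)
lift_definition plus_endo :: "'a endo \<Rightarrow> 'a endo \<Rightarrow> 'a endo" is "\<lambda>f g v. f v + g v"
  by (simp add: linear_iff algebra_simps)
lift_definition minus_endo :: "'a endo \<Rightarrow> 'a endo \<Rightarrow> 'a endo" is "\<lambda>f g v. f v - g v"
  by (simp add: linear_iff algebra_simps)
lift_definition uminus_endo :: "'a endo \<Rightarrow> 'a endo" is "\<lambda>f v. - f v"
  by (simp add: linear_iff algebra_simps)
lift_definition times_endo :: "'a endo \<Rightarrow> 'a endo \<Rightarrow> 'a endo" is "\<lambda>f g v. f (g v)"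
  by (simp add: linear_iff)
lift_definition scaleR_endo :: "real \<Rightarrow> 'a endo \<Rightarrow> 'a endo" is "\<lambda>c f v. c *\<^sub>R f v"
  by (simp add: linear_iff algebra_simps)

instance
proof
  show "(0 :: 'a endo) \<noteq> 1"
  proof transfer
    obtain b :: 'a where "b \<in> Basis"
      using nonempty_Basis by blast
    then show "(\<lambda>_. 0 :: 'a) \<noteq> (\<lambda>v. v)"
      using nonzero_Basis by (metis)
  qed
qed (transfer; simp add: linear_iff algebra_simps fun_eq_iff)+

end

section \<open>A complex representation of the braided algebra\<close>

text \<open>The Verma module of the braided algebra whose lowest weight vector \<open>w\<close> satisfies \<open>\<sigma> w = \<i> w\<close> has
  the basis \<open>w\<close>, \<open>x\<^sub>1 w\<close>, \<open>x\<^sub>2 w\<close>, \<open>x\<^sub>1\<^sup>2 w\<close>, with \<open>x\<^sub>1 x\<^sub>2 = x\<^sub>2 x\<^sub>1 = 0\<close> and \<open>x\<^sub>2\<^sup>2 = - x\<^sub>1\<^sup>2\<close> in the coinvariants. A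
  tuple lists the coordinates in this basis. The action of \<open>y\<^sub>1\<close> and \<open>y\<^sub>2\<close> follows from
  \<open>y\<^sub>i w = 0\<close> and the relations for the parameter -1; for instance
  \<open>y\<^sub>2 x\<^sub>1 w = (\<sigma> - \<sigma>\<^sup>-\<^sup>1) w = 2 \<i> w\<close>.\<close>

type_synonym complex4 = "complex \<times> complex \<times> complex \<times> complex"

lift_definition x1_op :: "complex4 endo" is "\<lambda>(a, b, c, d). (0, a, 0, b)"
  by (auto simp: linear_iff)
lift_definition x2_op :: "complex4 endo" is "\<lambda>(a, b, c, d). (0, 0, a, - c)"
  by (auto simp: linear_iff)
lift_definition y1_op :: "complex4 endo" is "\<lambda>(a, b, c, d). (- 2 * \<i> * c, 0, - 2 * \<i> * d, 0)"
  by (auto simp: linear_iff algebra_simps)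
lift_definition y2_op :: "complex4 endo" is "\<lambda>(a, b, c, d). (2 * \<i> * b, - 2 * \<i> * d, 0, 0)"
  by (auto simp: linear_iff algebra_simps)
text \<open>The rotation that sends \<open>x\<^sub>1\<close> to \<open>Re z x\<^sub>1 + Im z x\<^sub>2\<close>, for \<open>z \<in> {1, \<i>, -1, -\<i>}\<close>. It acts on the lowest
  weight vector by \<open>z\<close> and multiplies \<open>x\<^sub>1\<^sup>2\<close> by \<open>z\<^sup>2\<close>, so it acts on \<open>x\<^sub>1\<^sup>2 w\<close> by \<open>z\<^sup>3 = cnj z\<close>.\<close>

lift_definition rot_op :: "complex \<Rightarrow> complex4 endo" is
  "\<lambda>z (a, b, c, d). (z * a, z * (of_real (Re z) * b - of_real (Im z) * c),
     z * (of_real (Im z) * b + of_real (Re z) * c), cnj z * d)"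
  by (auto simp: linear_iff algebra_simps scaleR_conv_of_real)
lift_definition i_op :: "complex4 endo" is "\<lambda>(a, b, c, d). (\<i> * a, \<i> * b, \<i> * c, \<i> * d)"
  by (auto simp: linear_iff algebra_simps)

lemma endo_eqI:
  fixes f g :: "complex4 endo"
  assumes "\<And>a b c d. apply_endo f (a, b, c, d) = apply_endo g (a, b, c, d)"
  shows "f = g"
proof -
  have "apply_endo f v = apply_endo g v" for v
    using assms by (cases v) auto
  then show ?thesis
    by (simp add: apply_endo_inject[symmetric] fun_eq_iff)
qed

lemma of_real_endo: "(of_real r :: complex4 endo) = r *\<^sub>R 1"
  by (simp add: of_real_def)

lemmas endo_simps = of_real_endo zero_endo.rep_eq one_endo.rep_eq plus_endo.rep_eq minus_endo.rep_eq
  uminus_endo.rep_eq times_endo.rep_eq scaleR_endo.rep_eq x1_op.rep_eq x2_op.rep_eq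
  y1_op.rep_eq y2_op.rep_eq rot_op.rep_eq i_op.rep_eq zero_prod_def

fun gen_op :: "gen \<Rightarrow> complex4 endo" where
  "gen_op (GX i) = (if i = 1 then x1_op else x2_op)"
| "gen_op (GY i) = (if i = 1 then y1_op else y2_op)"
| "gen_op (GG g) = rot_op (Complex (of_rat (g $ 1 $ 1)) (of_rat (g $ 2 $ 1)))"

abbreviation "scal \<equiv> (\<lambda>q. of_real (of_rat q) :: complex4 endo)"

definition rep :: "gen ncpoly \<Rightarrow> complex4 endo" where
  "rep = evaluate scal gen_op"

interpretation scal: central_scalars scal
  by (rule real_algebra_scalars)

lemmas rep_simps = scal.evaluate_simps[where h = gen_op, folded rep_def]

definition rot :: "rat \<Rightarrow> rat \<Rightarrow> rat^2^2" where
  "rot p q = vector [vector [p, - q], vector [q, p]]"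

lemma rot_nth [simp]:
  "rot p q $ 1 $ 1 = p" "rot p q $ 1 $ 2 = - q" "rot p q $ 2 $ 1 = q" "rot p q $ 2 $ 2 = p"
  by (simp_all add: rot_def)

lemma rot_mult: "rot p q ** rot r s = rot (p * r - q * s) (p * s + q * r)"
  by (simp add: mat2_simps algebra_simps)

lemma rot_1_0: "mat 1 = rot 1 0"
  by (simp add: mat2_simps)

lemma sigma_eq_rot: "sigma_mat = rot 0 1"
  by (simp add: sigma_mat_def rot_def)

lemma mu_G222_eq: "mu_G222 = {rot 1 0, rot 0 1, rot (- 1) 0, rot 0 (- 1)}"
  by (auto simp: mu_G222_def rot_1_0 sigma_eq_rot rot_mult)

lemma orthogonal_mu_G222: "g \<in> mu_G222 \<Longrightarrow> orthogonal_mat g"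
  by (auto simp: mu_G222_eq orthogonal_mat_def mat2_simps)

lemma inv_sigma: "matrix_inv sigma_mat = rot 0 (- 1)"
  unfolding sigma_eq_rot by (rule matrix_inv_eqI) (simp_all add: rot_mult rot_1_0)

lemma cherednik_mu_G222: "cherednik mu_G222 (mu_G222_relations c)"
proof (rule cherednik.intro)
  show "mat 1 \<in> mu_G222"
    by (simp add: mu_G222_def)
  show "g ** h \<in> mu_G222" if "g \<in> mu_G222" "h \<in> mu_G222" for g h
    using that by (auto simp: mu_G222_eq rot_mult)
  have "GG sigma_mat \<in> gens mu_G222" "GG (matrix_inv sigma_mat) \<in> gens mu_G222"
    by (auto simp: gens_def mu_G222_eq sigma_eq_rot inv_sigma[unfolded sigma_eq_rot])
  then show "mu_G222_relations c \<subseteq> ncpolys (gens mu_G222)"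
    by (auto simp: mu_G222_relations_def gens_def)
qed

lemma rep_hom: "rep \<in> ring_hom (free_alg A) type_ring"
  by (intro ring_hom_memI) (simp_all add: rep_simps)

lemma rep_relations:
  assumes "r \<in> cherednik_relations mu_G222 (- 1) (mu_G222_relations (- 1))"
  shows "rep r = 0"
proof -
  have grp: "rep (grp g * grp h - grp (g ** h)) = 0" if "g \<in> mu_G222" "h \<in> mu_G222" for g h
    using that unfolding mu_G222_eq
    by (auto simp: rot_mult rep_simps Complex_eq intro!: endo_eqI; simp add: endo_simps algebra_simps)
  have one: "rep (grp (mat 1) - 1) = 0"
    unfolding rot_1_0 by (rule endo_eqI) (simp add: rep_simps endo_simps Complex_eq)
  have sym: "rep (sym_rel (- 1) GX) = 0" "rep (sym_rel (- 1) GY) = 0"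
    unfolding sym_rel_def by (rule endo_eqI; simp add: rep_simps endo_simps)+
  have gx: "rep (grp g * gx i - act g (gx i) * grp g) = 0" if "g \<in> mu_G222" for g i
    using that exhaust_2[of i] unfolding mu_G222_eq
    by (auto simp: gen_act_orthogonal rep_simps Complex_eq intro!: endo_eqI; simp add: endo_simps algebra_simps)
  have gy: "rep (grp g * gy i - act g (gy i) * grp g) = 0" if "g \<in> mu_G222" for g i
    using that exhaust_2[of i] orthogonal_mu_G222[OF that] unfolding mu_G222_eq
    by (auto simp: gen_act_orthogonal rep_simps Complex_eq intro!: endo_eqI; simp add: endo_simps algebra_simps)
  have "rep r = 0" if "r \<in> mu_G222_relations (- 1)" for r
    using that unfolding mu_G222_relations_def inv_sigma unfolding sigma_eq_rot
    using exhaust_2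
    by (auto simp: rep_simps Complex_eq intro!: endo_eqI; simp add: endo_simps algebra_simps)
  then show ?thesis
    using assms grp one sym gx gy unfolding cherednik_relations_def by blast
qed

lemma rep_act: "rep (act g p) = evaluate scal (\<lambda>a. rep (gen_act g a)) p"
  unfolding rep_def act_def by (rule evaluate_substitute[OF real_algebra_scalars])

lemma rep_as_sum:
  "rep p = (\<Sum>w\<in>Poly_Mapping.keys p. scal (Poly_Mapping.lookup p w) * prod_list (map gen_op w))"
  unfolding rep_def evaluate_def ..
lemmas rep_act_as_sum = rep_act[unfolded evaluate_def]

lemma prod_list_3_zero:
  assumes "Z \<in> {GX, GY}" "set w \<subseteq> range Z" "length w > 2"
  shows "prod_list (map gen_op w) = 0"
proof -
  obtain a b c w' where w: "w = a # b # c # w'"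
    using assms(3) by (cases w; cases "tl w"; cases "tl (tl w)") auto
  have "gen_op a * (gen_op b * gen_op c) = 0"
    using assms(1,2) unfolding w
    by (auto intro!: endo_eqI simp: endo_simps)
  then show ?thesis
    unfolding w by (simp add: mult.assoc[symmetric])
qed

text \<open>A positive degree invariant acts as 0, for a different reason in each degree: \<open>\<sigma>\<^sup>2\<close> negates degree 1; in degree
  2 only the squares of the two generators act nontrivially, by operators that are negatives of each other, and
  \<open>\<sigma>\<close> swaps the squares; and products of three generators of the same kind act as 0.\<close>

lemma rep_invariant:
  assumes Z: "Z \<in> {GX, GY}" and p: "p \<in> ncpolys (range Z)" "homogeneous d p" "d > 0"
    and inv: "\<And>g. g \<in> mu_G222 \<Longrightarrow> rep (act g p) = rep p"
  shows "rep p = 0"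
proof -
  have words: "set w \<subseteq> range Z" "length w = d" if "w \<in> Poly_Mapping.keys p" for w
    using p(1,2) that by (auto simp: ncpolys_iff homogeneous_def)
  consider "d = 1" | "d = 2" | "d > 2"
    using p(3) by linarith
  then have "\<exists>g\<in>mu_G222. rep (act g p) = - rep p"
  proof cases
    case 1
    have "rep (act (rot (- 1) 0) p) = - rep p"
      unfolding rep_act_as_sum rep_as_sum[of p] sum_negf[symmetric]
    proof (rule sum.cong)
      fix w assume "w \<in> Poly_Mapping.keys p"
      then obtain i where "w = [Z i]"
        using words[of w] 1 by (auto simp: length_Suc_conv)
      then show "scal (Poly_Mapping.lookup p w) * prod_list (map (\<lambda>a. rep (gen_act (rot (- 1) 0) a)) w) =
          - (scal (Poly_Mapping.lookup p w) * prod_list (map gen_op w))"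
        using Z exhaust_2[of i] orthogonal_mu_G222[of "rot (- 1) 0"]
        by (auto simp: mu_G222_eq gen_act_orthogonal rep_simps)
    qed simp
    then show ?thesis
      by (auto simp: mu_G222_eq)
  next
    case 2
    have sq: "rep (gen_act (rot 0 1) (Z i)) * rep (gen_act (rot 0 1) (Z j)) =
        - (gen_op (Z i) * gen_op (Z j))" for i j
      using Z exhaust_2[of i] exhaust_2[of j] orthogonal_mu_G222[of "rot 0 1"]
      by (auto simp: mu_G222_eq gen_act_orthogonal rep_simps intro!: endo_eqI; simp add: endo_simps)
    have "rep (act (rot 0 1) p) = - rep p"
      unfolding rep_act_as_sum rep_as_sum[of p] sum_negf[symmetric]
    proof (rule sum.cong)
      fix w assume "w \<in> Poly_Mapping.keys p"
      then obtain i j where w: "w = [Z i, Z j]"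
        using words[of w] 2 by (auto simp: length_Suc_conv numeral_2_eq_2)
      show "scal (Poly_Mapping.lookup p w) * prod_list (map (\<lambda>a. rep (gen_act (rot 0 1) a)) w) =
          - (scal (Poly_Mapping.lookup p w) * prod_list (map gen_op w))"
        unfolding w by (simp add: sq)
    qed simp
    then show ?thesis
      by (auto simp: mu_G222_eq)
  next
    case 3
    have "rep p = 0"
      unfolding rep_as_sum
      using words prod_list_3_zero[OF Z] 3 by (intro sum.neutral) simp
    then show ?thesis
      using inv[of "rot 1 0"] by (auto simp: mu_G222_eq)
  qed
  then obtain g where "g \<in> mu_G222" "rep (act g p) = - rep p"
    by blast
  with inv[of g] have "rep p + rep p = 0"
    by (metis add.right_inverse)
  then have "2 *\<^sub>R rep p = 0"
    by (simp only: scaleR_2)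
  then show ?thesis
    by simp
qed

lemma i_op_square: "i_op * i_op = - 1"
  by (rule endo_eqI) (simp add: endo_simps)

lemma i_op_commutes: "p \<in> ncpolys A \<Longrightarrow> i_op * rep p = rep p * i_op"
proof (induction p rule: ncpolys_induct)
  case (const q)
  then show ?case
    unfolding rep_def scal.evaluate_single by (simp add: of_real_endo)
next
  case (gen a p)
  have "i_op * gen_op a = gen_op a * i_op"
    by (cases a) (auto intro!: endo_eqI simp: endo_simps algebra_simps)
  with gen.IH show ?case
    unfolding rep_simps by (metis mult.assoc)
next
  case (add p q)
  then show ?case
    by (simp add: rep_simps distrib_left distrib_right)
qed

text \<open>On the basis \<open>w\<close>, \<open>x\<^sub>1 w\<close>, \<open>x\<^sub>2 w\<close>, \<open>x\<^sub>1\<^sup>2 w\<close>, the operators \<open>y\<^sub>1 x\<^sub>2\<close>, \<open>x\<^sub>1 y\<^sub>2\<close> and \<open>\<sigma>\<^sup>2\<close> are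
  diagonal, with entries \<open>2 \<i> (-1, 0, 1, 0)\<close>, \<open>2 \<i> (0, 1, 0, -1)\<close> and \<open>(-1, 1, 1, -1)\<close>.\<close>

lemma i_op_eq:
  "rep (scale (1/2) (grp (rot (- 1) 0) * (gy 1 * gx 2 + gx 1 * gy 2))) = i_op"
  by (rule endo_eqI) (simp add: rep_simps endo_simps Complex_eq of_rat_divide scaleR_conv_of_real[where 'a = complex]
      algebra_simps)

text \<open>Multiplication by \<open>\<i>\<close> commutes with the complex linear action of every generator, and
  \<open>i_op_eq\<close> exhibits it as the action of an element of the rational algebra.\<close>

theorem braided_representation:
  obtains \<rho> :: "gen ncpoly set set \<Rightarrow> complex4 endo" and j :: "complex4 endo"
  where "\<rho> \<in> ring_hom (restricted_braided_mu_G222 (- 1)) type_ring"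
    and "j \<in> \<rho> ` carrier (restricted_braided_mu_G222 (- 1))" and "j * j = - 1"
    and "\<And>x. x \<in> carrier (restricted_braided_mu_G222 (- 1)) \<Longrightarrow> j * \<rho> x = \<rho> x * j"
proof -
  let ?R = "mu_G222_relations (- 1)"
  let ?proj = "cherednik.proj mu_G222 (- 1) ?R"
  note carrier = cherednik.carrier_restricted[OF cherednik_mu_G222[of "- 1"], of "- 1",
    folded restricted_braided_mu_G222_def]
  obtain \<rho> where \<rho>: "\<rho> \<in> ring_hom (restricted_braided_mu_G222 (- 1)) type_ring"
    "\<And>p. p \<in> ncpolys (gens mu_G222) \<Longrightarrow> \<rho> (?proj p) = rep p"
    unfolding restricted_braided_mu_G222_def
  proof (rule cherednik.hom_factors_through_restricted[where \<epsilon> = "- 1",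
        OF cherednik_mu_G222[of "- 1"] rep_hom], goal_cases)
    case (1 r)
    then show ?case
      by (intro rep_relations)
  next
    case (2 Z p d)
    then show ?case
      by (intro rep_invariant[of Z p d]) blast+
  next
    case (3 \<rho>)
    then show ?case
      by blast
  qed
  have "scale (1/2) (grp (rot (- 1) 0) * (gy 1 * gx 2 + gx 1 * gy 2)) \<in> ncpolys (gens mu_G222)"
    by (simp add: gens_def mu_G222_eq)
  then have "i_op \<in> \<rho> ` carrier (restricted_braided_mu_G222 (- 1))"
    unfolding carrier using \<rho>(2) i_op_eq by (metis imageI)
  moreover have "i_op * \<rho> x = \<rho> x * i_op"
    if "x \<in> carrier (restricted_braided_mu_G222 (- 1))" for x
    using that \<rho>(2) i_op_commutes unfolding carrier by auto
  ultimately show thesis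
    using that[OF \<rho>(1) _ i_op_square] by blast
qed

section \<open>Comparison of the two algebras\<close>

theorem proposition6p3:
  fixes c :: rat
  assumes "c = 1"
  shows "\<not> alg_isomorphic (restricted_cherednik_G222 c) (restricted_braided_mu_G222 (- c))"
proof
  let ?A = "restricted_cherednik_G222 1" and ?B = "restricted_braided_mu_G222 (- 1)"
  assume "alg_isomorphic (restricted_cherednik_G222 c) (restricted_braided_mu_G222 (- c))"
  then obtain f where f: "f \<in> ring_iso ?A ?B"
    unfolding alg_isomorphic_def assms by blast
  obtain \<rho> :: "gen ncpoly set set \<Rightarrow> complex4 endo" and j
    where \<rho>: "\<rho> \<in> ring_hom ?B type_ring" and j: "j \<in> \<rho> ` carrier ?B" "j * j = - 1"
      and central: "\<And>x. x \<in> carrier ?B \<Longrightarrow> j * \<rho> x = \<rho> x * j"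
    by (rule braided_representation) blast
  have hom: "f \<in> ring_hom ?A ?B" and surj: "f ` carrier ?A = carrier ?B"
    using f by (auto simp: ring_iso_def bij_betw_def)
  have "\<rho> \<circ> f \<in> ring_hom ?A type_ring"
    by (rule ring_hom_trans[OF hom \<rho>])
  then show False
  proof (rule restricted_G222_no_imaginary_unit)
    show "j \<in> (\<rho> \<circ> f) ` carrier ?A"
      using j(1) unfolding surj[symmetric] image_comp .
    show "j * (\<rho> \<circ> f) x = (\<rho> \<circ> f) x * j" if "x \<in> carrier ?A" for x
      using central surj that by auto
  qed (rule j(2))
qed

end
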